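(* Let $\Theta$ be a compact set included in $$\left\{(p,\alpha,\beta)\in(0,1/2)\times\mathbb{S}^1\times\mathbb{S}^1,\ \beta-\alpha\notin\left\{-\tfrac{2\pi}{3},0,\tfrac{2\pi}{3},\pi\right\}+2\pi\mathbb{Z}\right\},$$ let $\theta_0=(p_0,\alpha_0,\beta_0)\in\Theta$, and let $f$ be a density on $\mathbb{S}^1$ with $f^{\star l}\in\mathbb{R}\setminus\{0\}$ for all $l\in\{1,2,3,4\}$. Let $X_1,\dots,X_n$ be i.i.d. with density $g(x)=p_0f(x-\alpha_0)+(1-p_0)f(x-\beta_0)$, and let $\hat\theta_n=\operatorname{argmin}_{\theta\in\Theta}S_n(\theta)$. Then $\hat\theta_n\to\theta_0\pmod\pi$ in probability, that is: for all $\epsilon>0$, $$\mathbb{P}\left(\|\hat\theta_n-\theta_0\|\le\epsilon\ \text{ or }\ \|\hat\theta_n-\theta_0-\pi\|\le\epsilon\right)\longrightarrow 1\quad\text{as } n\to+\infty .$$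
   Context: $\mathbb{S}^1=\mathbb{R}/2\pi\mathbb{Z}$; a density $f$ on $\mathbb{S}^1$ is nonnegative with $\int_{\mathbb{S}^1}f\,dx=1$. Fourier coefficients: $\phi^{\star l}=\int_{\mathbb{S}^1}\phi(x)e^{-ilx}\frac{dx}{2\pi}$, $l\in\mathbb{Z}$. For $\theta=(p,\alpha,\beta)$ and $l\in\mathbb{Z}$, $M^l(\theta)=pe^{-i\alpha l}+(1-p)e^{-i\beta l}$. The empirical contrast is, for $n\ge2$, $$S_n(\theta)=\frac{1}{4\pi^2n(n-1)}\sum_{l=-4}^{4}\sum_{1\le k\ne j\le n}\Im\left(e^{ilX_k}M^l(\theta)\right)\Im\left(e^{ilX_j}M^l(\theta)\right).$$ $\theta_0+\pi$ denotes $(p_0,\alpha_0+\pi,\beta_0+\pi)$. $\|\cdot\|$ is the Euclidean norm, differences of angles being represented in $(-\pi,\pi]$. *)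

theory Defs
  imports "HOL-Probability.Probability"
begin

definition circle_rel :: "real \<Rightarrow> real \<Rightarrow> bool" where
  "circle_rel x y \<longleftrightarrow> (\<exists>k::int. x - y = 2 * pi * of_int k)"

quotient_type circle = real / circle_rel
proof (rule equivpI)
  show "reflp circle_rel"
    by (auto simp: reflp_def circle_rel_def intro: exI[of _ 0])
  show "symp circle_rel"
  proof (rule sympI)
    fix x y assume "circle_rel x y"
    then obtain k :: int where "x - y = 2 * pi * of_int k"
      by (auto simp: circle_rel_def)
    then have "y - x = 2 * pi * of_int (- k)"
      by simp
    then show "circle_rel y x"
      unfolding circle_rel_def by blast
  qed
  show "transp circle_rel"
  proof (rule transpI)
    fix x y z assume "circle_rel x y" "circle_rel y z"
    then obtain k m :: int where "x - y = 2 * pi * of_int k" "y - z = 2 * pi * of_int m"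
      by (auto simp: circle_rel_def)
    then have "x - z = 2 * pi * of_int (k + m)"
      by (simp add: algebra_simps)
    then show "circle_rel x z"
      unfolding circle_rel_def by blast
  qed
qed

lift_definition circ :: "real \<Rightarrow> circle" is "\<lambda>x. x" .

instantiation circle :: ab_group_add
begin

lift_definition zero_circle :: circle is "0 :: real" .

lift_definition plus_circle :: "circle \<Rightarrow> circle \<Rightarrow> circle" is "(+)"
proof -
  fix x x' y y' :: real
  assume "circle_rel x x'" "circle_rel y y'"
  then obtain k m :: int where "x - x' = 2 * pi * of_int k" "y - y' = 2 * pi * of_int m"
    by (auto simp: circle_rel_def)
  then have "x + y - (x' + y') = 2 * pi * of_int (k + m)"
    by (simp add: algebra_simps)
  then show "circle_rel (x + y) (x' + y')"
    unfolding circle_rel_def by blast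
qed

lift_definition uminus_circle :: "circle \<Rightarrow> circle" is "uminus"
proof -
  fix x x' :: real
  assume "circle_rel x x'"
  then obtain k :: int where "x - x' = 2 * pi * of_int k"
    by (auto simp: circle_rel_def)
  then have "- x - - x' = 2 * pi * of_int (- k)"
    by simp
  then show "circle_rel (- x) (- x')"
    unfolding circle_rel_def by blast
qed

definition minus_circle :: "circle \<Rightarrow> circle \<Rightarrow> circle" where
  "minus_circle x y = x + - y"

instance
proof
  fix a b c :: circle
  show "a + b + c = a + (b + c)"
    by transfer (auto simp: circle_rel_def add.assoc intro: exI[of _ 0])
  show "a + b = b + a"
    by transfer (auto simp: circle_rel_def intro: exI[of _ 0])
  show "0 + a = a"
    by transfer (auto simp: circle_rel_def intro: exI[of _ 0])
  show "- a + a = 0"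
    by transfer (auto simp: circle_rel_def intro: exI[of _ 0])
  show "a - b = a + - b"
    by (rule minus_circle_def)
qed

end

instantiation circle :: topological_space
begin

definition open_circle :: "circle set \<Rightarrow> bool" where
  "open_circle U \<longleftrightarrow> open (circ -` U)"

instance
proof
  show "open (UNIV :: circle set)"
    by (simp add: open_circle_def)
  show "open (S \<inter> T)" if "open S" "open T" for S T :: "circle set"
    using that by (simp add: open_circle_def open_Int)
  show "open (\<Union>K)" if "\<forall>S\<in>K. open S" for K :: "circle set set"
    using that by (auto simp: open_circle_def vimage_Union)
qed

end

lemma circ_eq_iff: "circ x = circ y \<longleftrightarrow> (\<exists>k::int. x - y = 2 * pi * of_int k)"
  by transfer (simp add: circle_rel_def)

lemma circ_surj: "\<exists>t. x = circ t"
  by transfer (metis circle_equivp equivp_reflp)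

lemma circ_add: "circ x + circ y = circ (x + y)"
  by transfer (auto simp: circle_rel_def intro: exI[of _ 0])

lemma circ_diff: "circ x - circ y = circ (x - y)"
  unfolding minus_circle_def by transfer (auto simp: circle_rel_def intro: exI[of _ 0])

lemma continuous_on_circ: "continuous_on UNIV circ"
  by (auto simp: continuous_on_open_vimage open_circle_def)

definition circ_rep :: "circle \<Rightarrow> real" where
  "circ_rep x = (THE t. - pi < t \<and> t \<le> pi \<and> circ t = x)"

lemma ex1_circ_rep: "\<exists>!t. - pi < t \<and> t \<le> pi \<and> circ t = x"
proof -
  obtain s where s: "x = circ s"
    using circ_surj by blast
  define k where "k = \<lceil>(s - pi) / (2 * pi)\<rceil>"
  have "of_int k - 1 < (s - pi) / (2 * pi)" "(s - pi) / (2 * pi) \<le> of_int k"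
    unfolding k_def by linarith+
  then have "- pi < s - 2 * pi * of_int k" "s - 2 * pi * of_int k \<le> pi"
    by (simp_all add: field_simps)
  moreover have "circ (s - 2 * pi * of_int k) = x"
    unfolding s circ_eq_iff by (rule exI[of _ "- k"]) simp
  moreover have "t = u"
    if "- pi < t \<and> t \<le> pi \<and> circ t = x" "- pi < u \<and> u \<le> pi \<and> circ u = x" for t u
  proof -
    from that obtain m :: int where m: "t - u = 2 * pi * of_int m"
      using circ_eq_iff[of t u] by auto
    have "\<bar>t - u\<bar> < 2 * pi"
      using that by linarith
    then have "2 * pi * \<bar>of_int m :: real\<bar> < 2 * pi * 1"
      unfolding m by (simp add: abs_mult)
    then have "\<bar>of_int m :: real\<bar> < 1"
      using mult_less_cancel_left_pos[of "2 * pi"] pi_gt_zero by (metis mult_2 add_pos_pos)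
    then have "m = 0"
      by linarith
    with m show ?thesis
      by simp
  qed
  ultimately show ?thesis
    by blast
qed

lift_definition circ_exp :: "int \<Rightarrow> circle \<Rightarrow> complex" is
  "\<lambda>l x. exp (\<i> * of_int l * of_real x)"
proof -
  fix l :: int and x y :: real
  assume "circle_rel x y"
  then obtain k :: int where "x - y = 2 * pi * of_int k"
    by (auto simp: circle_rel_def)
  then have "x = y + 2 * pi * of_int k"
    by simp
  then have "\<i> * of_int l * of_real x =
      \<i> * of_int l * of_real y + complex_of_real (of_int (2 * (l * k)) * pi) * \<i>"
    by (simp add: algebra_simps)
  then show "exp (\<i> * of_int l * complex_of_real x) = exp (\<i> * of_int l * of_real y)"
    unfolding exp_eq by blast
qed

text \<open>This is the unnormalised measure $dx$, of total mass $2\pi$.\<close>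

definition circle_lebesgue :: "circle measure" where
  "circle_lebesgue = distr (restrict_space lborel {- pi<..pi}) borel circ"

lemma emeasure_circle_lebesgue_UNIV: "emeasure circle_lebesgue UNIV = ennreal (2 * pi)"
proof -
  have "circ \<in> measurable (restrict_space lborel {- pi<..pi}) borel"
    by (intro measurable_restrict_space1)
       (simp add: borel_measurable_continuous_onI continuous_on_circ)
  then show ?thesis
    by (simp add: circle_lebesgue_def emeasure_distr emeasure_restrict_space space_restrict_space)
qed

definition circle_density :: "(circle \<Rightarrow> real) \<Rightarrow> bool" where
  "circle_density f \<longleftrightarrow>
     f \<in> borel_measurable borel \<and> (\<forall>x. 0 \<le> f x) \<and>
     integrable circle_lebesgue f \<and> (LINT x|circle_lebesgue. f x) = 1"

definition fourier_coeff :: "(circle \<Rightarrow> complex) \<Rightarrow> int \<Rightarrow> complex" where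
  "fourier_coeff \<phi> l = (LINT x|circle_lebesgue. \<phi> x * circ_exp (- l) x) / (2 * of_real pi)"

type_synonym param = "real \<times> circle \<times> circle"

definition admissible :: "param set" where
  "admissible = {(p, \<alpha>, \<beta>). 0 < p \<and> p < 1/2 \<and>
     \<beta> - \<alpha> \<notin> {circ (- (2 * pi / 3)), circ 0, circ (2 * pi / 3), circ pi}}"

fun mixture :: "(circle \<Rightarrow> real) \<Rightarrow> param \<Rightarrow> circle \<Rightarrow> real" where
  "mixture f (p, \<alpha>, \<beta>) x = p * f (x - \<alpha>) + (1 - p) * f (x - \<beta>)"

fun mix_fourier :: "int \<Rightarrow> param \<Rightarrow> complex" where
  "mix_fourier l (p, \<alpha>, \<beta>) = of_real p * circ_exp (- l) \<alpha> + of_real (1 - p) * circ_exp (- l) \<beta>"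

text \<open>The sample is \<open>x 1, \<dots>, x n\<close>; \<open>x 0\<close> is not used.\<close>

definition contrast :: "nat \<Rightarrow> (nat \<Rightarrow> circle) \<Rightarrow> param \<Rightarrow> real" where
  "contrast n x \<theta> = 1 / (4 * pi\<^sup>2 * real n * (real n - 1)) *
     (\<Sum>l\<in>{-4..4}. \<Sum>(k, j)\<in>{(k, j). k \<in> {1..n} \<and> j \<in> {1..n} \<and> k \<noteq> j}.
        Im (circ_exp l (x k) * mix_fourier l \<theta>) * Im (circ_exp l (x j) * mix_fourier l \<theta>))"

fun shift_pi :: "param \<Rightarrow> param" where
  "shift_pi (p, \<alpha>, \<beta>) = (p, \<alpha> + circ pi, \<beta> + circ pi)"

text \<open>The norm on the product type \<^typ>\<open>real \<times> real \<times> real\<close> is the Euclidean one.\<close>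

fun param_diff :: "param \<Rightarrow> param \<Rightarrow> real \<times> real \<times> real" where
  "param_diff (p, \<alpha>, \<beta>) (p', \<alpha>', \<beta>') = (p - p', circ_rep (\<alpha> - \<alpha>'), circ_rep (\<beta> - \<beta>'))"

end

theory Submission
  imports Defs "HOL-Real_Asymp.Real_Asymp"
begin

text \<open>
  Write \<open>F l\<close> for the (real) \<open>l\<close>-th trigonometric moment of \<open>f\<close>. The moments of the observations are
  \<open>m l = F l * cnj (M\<^sup>l(\<theta>\<^sub>0))\<close>, and up to a factor that does not depend on \<open>\<theta>\<close> the contrast
  \<open>S\<^sub>n\<close> is, uniformly in \<open>\<theta>\<close>, within \<open>O(1/n)\<close> plus the error of the empirical moments of
  \<open>\<theta> \<mapsto> \<Sum>\<^sub>l (Im (m l * M\<^sup>l(\<theta>)))\<^sup>2\<close>. This limit is continuous and vanishes at \<open>\<theta>\<^sub>0\<close>. By compactness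
  it is bounded away from zero off a neighbourhood of \<open>{\<theta>\<^sub>0, \<theta>\<^sub>0 + \<pi>}\<close>, provided these are its only zeros.

  A zero gives \<open>\<lambda>\<^sub>1 sin (l t\<^sub>1) + \<dots> + \<lambda>\<^sub>4 sin (l t\<^sub>4) = 0\<close> for \<open>l = 1, \<dots>, 4\<close>, where the \<open>t\<^sub>j\<close> are the
  differences of the angles of \<open>\<theta>\<close> and \<open>\<theta>\<^sub>0\<close> and the \<open>\<lambda>\<^sub>j\<close> are products of mixture weights. As
  \<open>sin (l t)\<close> is \<open>sin t\<close> times a polynomial of degree \<open>l - 1\<close> in \<open>cos t\<close>, a Vandermonde argument
  shows that the sum of the \<open>\<lambda>\<^sub>j sin t\<^sub>j\<close> over each level set of \<open>j \<mapsto> cos t\<^sub>j\<close> vanishes; the excluded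
  values of \<open>\<beta> - \<alpha>\<close> are exactly the remaining exceptional configurations.
\<close>

section \<open>Identifiability of four weighted angles\<close>

text \<open>Pairing the moments with a polynomial that vanishes at all nodes except \<open>x\<close>
  isolates the sum at \<open>x\<close>. Its degree is one less than the number of distinct nodes, so
  \<open>card I\<close> moments suffice even when nodes coincide.\<close>

lemma sum_over_level_set_eq_0:
  fixes a c :: "'i \<Rightarrow> 'a::field"
  assumes "finite I" and moments: "\<And>k. k < card I \<Longrightarrow> (\<Sum>j\<in>I. a j * c j ^ k) = 0"
  shows "(\<Sum>j\<in>I. if c j = x then a j else 0) = 0"
proof (cases "x \<in> c ` I")
  case False
  then show ?thesis
    by (intro sum.neutral) auto
next
  case True
  \<comment> \<open>\<open>q\<close> vanishes at every \<open>c j\<close> other than \<open>x\<close>.\<close>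
  define q where "q = (\<Prod>y\<in>c ` I - {x}. [:- y, 1:])"
  have "degree q = card (c ` I - {x})"
    unfolding q_def by (subst degree_prod_sum_eq) auto
  also have "\<dots> < card (c ` I)"
    using True assms(1) by (intro psubset_card_mono) auto
  also have "\<dots> \<le> card I"
    using assms(1) by (rule card_image_le)
  finally have deg: "degree q < card I" .
  have "(\<Sum>j\<in>I. a j * poly q (c j)) = (\<Sum>k\<le>degree q. coeff q k * (\<Sum>j\<in>I. a j * c j ^ k))"
    by (simp add: poly_altdef sum_distrib_left mult_ac) (rule sum.swap)
  also have "\<dots> = 0"
    using deg by (intro sum.neutral) (auto simp: moments)
  also have "(\<Sum>j\<in>I. a j * poly q (c j)) = (\<Sum>j\<in>I. (if c j = x then a j else 0) * poly q x)"
    using assms(1) by (intro sum.cong) (auto simp: q_def poly_prod)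
  finally show ?thesis
    using assms(1) by (auto simp: sum_distrib_right[symmetric] q_def poly_prod)
qed

lemma sum_over_level_set_eq_0_4:
  fixes a1 a2 a3 a4 c1 c2 c3 c4 :: real
  assumes "a1 + a2 + a3 + a4 = 0"
    and "a1 * c1 + a2 * c2 + a3 * c3 + a4 * c4 = 0"
    and "a1 * c1\<^sup>2 + a2 * c2\<^sup>2 + a3 * c3\<^sup>2 + a4 * c4\<^sup>2 = 0"
    and "a1 * c1 ^ 3 + a2 * c2 ^ 3 + a3 * c3 ^ 3 + a4 * c4 ^ 3 = 0"
  shows "(if c1 = x then a1 else 0) + (if c2 = x then a2 else 0) +
    (if c3 = x then a3 else 0) + (if c4 = x then a4 else 0) = 0"
proof -
  have "(\<Sum>j<4. ([a1, a2, a3, a4] ! j) * ([c1, c2, c3, c4] ! j) ^ k) = 0" if "k < 4" for k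
  proof -
    from that consider "k = 0" | "k = 1" | "k = 2" | "k = 3"
      by linarith
    then show ?thesis
      by cases (use assms in \<open>simp_all add: eval_nat_numeral add_ac\<close>)
  qed
  then have "(\<Sum>j<4. if [c1, c2, c3, c4] ! j = x then [a1, a2, a3, a4] ! j else 0) = 0"
    by (intro sum_over_level_set_eq_0) auto
  then show ?thesis
    by (simp add: eval_nat_numeral add_ac cong: if_cong)
qed

text \<open>Within a level set of the real part all imaginary parts agree up to sign, so a weighted
  sum over it becomes a signed sum of weights times a single sine.\<close>

lemma unit_complex_eq_or_cnj:
  fixes z w :: complex
  assumes "cmod z = 1" "cmod w = 1" "Re z = Re w"
  shows "z = w \<and> Im z = Im w \<or> z = cnj w \<and> Im z = - Im w"
proof -
  have "(Re z)\<^sup>2 + (Im z)\<^sup>2 = 1" "(Re w)\<^sup>2 + (Im w)\<^sup>2 = 1"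
    using assms by (auto simp: cmod_def)
  then have "(Im z)\<^sup>2 = (Im w)\<^sup>2"
    using assms(3) by simp
  then show ?thesis
    using assms(3) by (auto simp: power2_eq_iff complex_eq_iff)
qed

text \<open>For \<open>z\<close> of argument t these are the identities expressing sin (l t) as sin
  t times a Chebyshev polynomial of the second kind in cos t.\<close>

lemma Im_power_unit:
  fixes z :: complex
  assumes "cmod z = 1"
  shows "Im (z ^ 2) = 2 * Im z * Re z"
    and "Im (z ^ 3) = 4 * Im z * (Re z)\<^sup>2 - Im z"
    and "Im (z ^ 4) = 8 * Im z * Re z ^ 3 - 4 * Im z * Re z"
proof -
  have s: "Im z * Im z = 1 - Re z * Re z"
    using assms by (auto simp: cmod_def power2_eq_square)
  show "Im (z ^ 2) = 2 * Im z * Re z"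
    by (simp add: power2_eq_square)
  show "Im (z ^ 3) = 4 * Im z * (Re z)\<^sup>2 - Im z"
    using s by (simp add: power3_eq_cube power2_eq_square) (simp add: algebra_simps)
  show "Im (z ^ 4) = 8 * Im z * Re z ^ 3 - 4 * Im z * Re z"
    using s by (simp add: power4_eq_xxxx power3_eq_cube) algebra
qed

text \<open>The weight of \<open>z4\<close> is the largest. If \<open>z4\<close> is not real, only
  \<open>z2\<close> and \<open>z3\<close> together can balance it, both being its conjugate; then
  \<open>z1\<close> is real and \<open>z4 * cnj z2\<close> is a cube root of unity. If
  \<open>z4\<close> is real, either \<open>z2\<close> is real as well, or \<open>z2\<close> is
  balanced by \<open>z3 = cnj z2\<close> alone, which forces equal weights.\<close>

lemma four_unit_complex_rigidity:
  fixes z1 z2 z3 z4 :: complex and p q :: real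
  assumes unit: "cmod z1 = 1" "cmod z2 = 1" "cmod z3 = 1" "cmod z4 = 1"
    and rel: "z1 * z4 = z2 * z3" and ne: "z4 \<noteq> z2" "z4 \<noteq> z3"
    and p: "0 < p" "p < 1/2" and q: "0 < q" "q < 1/2"
    and eq: "\<And>l. l \<in> {1,2,3,4} \<Longrightarrow> p * q * Im (z1 ^ l) + p * (1 - q) * Im (z2 ^ l) +
      (1 - p) * q * Im (z3 ^ l) + (1 - p) * (1 - q) * Im (z4 ^ l) = 0"
  shows "(z4 * cnj z2) ^ 3 = 1 \<or> (z4 * cnj z2) ^ 2 = 1 \<or> p = q \<and> z1 = z4 \<and> z4\<^sup>2 = 1"
proof -
  define l1 l2 l3 l4 where l_defs: "l1 = p * q" "l2 = p * (1 - q)" "l3 = (1 - p) * q" "l4 = (1 - p) * (1 - q)"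
  have lpos: "0 < l1" "0 < l2" "0 < l3" "0 < l4"
    using p q by (auto simp: l_defs)
  \<comment> \<open>These factorisations give the ordering of the weights; every factor is positive
    because \<open>p\<close> and \<open>q\<close> lie in (0, 1/2).\<close>
  have lin: "l2 - l1 = p * (1 - 2 * q)" "l3 - l1 = q * (1 - 2 * p)" "l4 - l2 = (1 - 2 * p) * (1 - q)"
     "l4 - l3 = (1 - 2 * q) * (1 - p)" "l4 + l1 - l2 - l3 = (1 - 2 * p) * (1 - 2 * q)"
    by (auto simp: l_defs algebra_simps)
  have pos: "0 < p * (1 - 2 * q)" "0 < q * (1 - 2 * p)" "0 < (1 - 2 * p) * (1 - q)"
     "0 < (1 - 2 * q) * (1 - p)" "0 < (1 - 2 * p) * (1 - 2 * q)"
    using p q by auto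
  have lt: "l1 < l2" "l1 < l3" "l2 < l4" "l3 < l4" "l2 + l3 < l4 + l1"
    using pos unfolding lin[symmetric] by simp_all
  have nz: "z1 \<noteq> 0" "z2 \<noteq> 0" "z3 \<noteq> 0" "z4 \<noteq> 0"
    using unit by auto
  have ne': "z1 \<noteq> z2" "z1 \<noteq> z3"
    using rel ne nz by auto
  have inv: "z1 * cnj z1 = 1" "z2 * cnj z2 = 1" "z3 * cnj z3 = 1" "z4 * cnj z4 = 1"
    using unit by (simp_all add: complex_norm_square[symmetric])
  note E = eq[folded l_defs]
  have e1: "l1 * Im z1 + l2 * Im z2 + l3 * Im z3 + l4 * Im z4 = 0"
    using E[of 1] by simp
  have e2: "(l1 * Im z1) * Re z1 + (l2 * Im z2) * Re z2 + (l3 * Im z3) * Re z3 + (l4 * Im z4) * Re z4 = 0"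
    using E[of 2] by (simp add: Im_power_unit unit algebra_simps)
  \<comment> \<open>The polynomials for l = 3 and l = 4 also contain a term of lower degree; it is
    removed by \<open>e1\<close> and \<open>e2\<close> respectively, leaving pure power moments of
    the real parts.\<close>
  have e3: "(l1 * Im z1) * (Re z1)\<^sup>2 + (l2 * Im z2) * (Re z2)\<^sup>2 + (l3 * Im z3) * (Re z3)\<^sup>2 + (l4 * Im z4) * (Re z4)\<^sup>2 = 0"
    using E[of 3] e1 by (simp add: Im_power_unit unit algebra_simps)
  have e4: "(l1 * Im z1) * Re z1 ^ 3 + (l2 * Im z2) * Re z2 ^ 3 + (l3 * Im z3) * Re z3 ^ 3 + (l4 * Im z4) * Re z4 ^ 3 = 0"
    using E[of 4] e2 by (simp add: Im_power_unit unit algebra_simps)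
  note G = sum_over_level_set_eq_0_4[OF e1 e2 e3 e4]
  note R12 = unit_complex_eq_or_cnj[OF unit(1,2)] and R13 = unit_complex_eq_or_cnj[OF unit(1,3)]
    and R14 = unit_complex_eq_or_cnj[OF unit(1,4)] and R24 = unit_complex_eq_or_cnj[OF unit(2,4)]
    and R34 = unit_complex_eq_or_cnj[OF unit(3,4)] and R23 = unit_complex_eq_or_cnj[OF unit(2,3)]
  have real: "z = 1 \<or> z = -1" if "cmod z = 1" "Im z = 0" for z
    using that by (auto simp: cmod_eq_Re complex_eq_iff abs_if split: if_splits)
  show ?thesis
  proof (cases "Im z4 = 0")
    case s4: False
    \<comment> \<open>In any other configuration the weight \<open>l4\<close> cannot be balanced in the level set of \<open>z4\<close>.\<close>
    have A: "Re z1 \<noteq> Re z4 \<and> Re z2 = Re z4 \<and> Re z3 = Re z4" (is ?A)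
    proof (rule ccontr)
      assume na: "\<not> ?A"
      \<comment> \<open>As \<open>z2\<close> and \<open>z3\<close> differ from \<open>z4\<close>,
        they share its real part only as its conjugate and then count negatively. As
        \<open>z1\<close> differs from both, it must then be \<open>z4\<close> itself and counts
        positively.\<close>
      have s2: "Im z2 = - Im z4" if "Re z2 = Re z4" using R24 that ne by auto
      have s3: "Im z3 = - Im z4" if "Re z3 = Re z4" using R34 that ne by auto
      have s1: "Im z1 = Im z4 \<or> Im z1 = - Im z4" if "Re z1 = Re z4" using R14 that by auto
      have s12: "Im z1 = Im z4" if "Re z1 = Re z4" "Re z2 = Re z4"
        using R12 R24 that ne ne' by auto
      have s13: "Im z1 = Im z4" if "Re z1 = Re z4" "Re z3 = Re z4"
        using R13 R34 that ne ne' by auto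
      \<comment> \<open>Here \<open>r\<close> is the signed total weight of the level set of
        \<open>z4\<close>. It could fail to be positive only if \<open>l2\<close> and
        \<open>l3\<close> were both subtracted without \<open>l1\<close> being added, and that is
        configuration \<open>?A\<close>.\<close>
      have "\<exists>r. r * Im z4 = 0 \<and> r > 0"
      proof (cases "Re z1 = Re z4")
        case t1: True
        show ?thesis
        proof (cases "Re z2 = Re z4 \<or> Re z3 = Re z4")
          case True
          then have "Im z1 = Im z4" using s12 s13 t1 by auto
          then have "(l1 - (if Re z2 = Re z4 then l2 else 0) - (if Re z3 = Re z4 then l3 else 0) + l4) * Im z4 = 0"
            using G[of "Re z4"] s2 s3 t1 by (auto simp: algebra_simps split: if_splits)
          moreover have "l1 - (if Re z2 = Re z4 then l2 else 0) - (if Re z3 = Re z4 then l3 else 0) + l4 > 0"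
            using lt lpos by auto
          ultimately show ?thesis by blast
        next
          case False
          then have "(l4 + l1) * Im z4 = 0 \<or> (l4 - l1) * Im z4 = 0"
            using G[of "Re z4"] s1[OF t1] t1 by (auto simp: algebra_simps)
          moreover have "l4 + l1 > 0" "l4 - l1 > 0" using lt lpos by auto
          ultimately show ?thesis by blast
        qed
      next
        case t1: False
        have "(l4 - (if Re z2 = Re z4 then l2 else 0) - (if Re z3 = Re z4 then l3 else 0)) * Im z4 = 0"
          using G[of "Re z4"] s2 s3 t1 by (auto simp: algebra_simps split: if_splits)
        moreover have "l4 - (if Re z2 = Re z4 then l2 else 0) - (if Re z3 = Re z4 then l3 else 0) > 0"
          using lt lpos na t1 by auto
        ultimately show ?thesis by blast
      qed
      then show False using s4 by auto
    qed
    then have z23: "z2 = cnj z4" "z3 = cnj z4"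
      using R24 R34 ne by auto
    \<comment> \<open>By \<open>A\<close> the other three points have a different real part, so
      \<open>z1\<close> is alone in its level set.\<close>
    have "l1 * Im z1 = 0"
      using G[of "Re z1"] A by (auto split: if_splits)
    then have z1: "z1 = 1 \<or> z1 = -1"
      using real[OF unit(1)] lpos by auto
    have "z1 * z4 ^ 3 = 1"
      using rel z23 inv by (simp add: power3_eq_cube) algebra
    then have "z1 * (z1 * z4 ^ 3) = z1"
      by simp
    moreover have z11: "z1 * z1 = 1"
      using z1 by auto
    ultimately have "z4 ^ 3 = z1"
      unfolding mult.assoc[symmetric] by simp
    then have "(z4 ^ 3) ^ 2 = 1"
      using z11 by (simp only: power2_eq_square)
    then have "(z4 * cnj z2) ^ 3 = 1"
      using z23 by (simp add: power3_eq_cube power2_eq_square mult_ac)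
    then show ?thesis by blast
  next
    case s4: True
    then have z4: "z4 = 1 \<or> z4 = -1"
      using real[OF unit(4)] by auto
    show ?thesis
    proof (cases "Im z2 = 0")
      case s2: False
      have n24: "Re z2 \<noteq> Re z4"
        using R24 s2 s4 by auto
      \<comment> \<open>Now \<open>z4\<close> is outside the level set of \<open>z2\<close>. If
        \<open>z1\<close> is inside, it is the conjugate of \<open>z2\<close> with the smaller
        weight \<open>l1\<close>, and \<open>z3\<close>, being different from \<open>z1\<close>,
        could only add to the side of \<open>z2\<close>. Hence \<open>z3\<close> has to balance
        \<open>z2\<close> without \<open>z1\<close>.\<close>
      have A: "Re z3 = Re z2 \<and> Re z1 \<noteq> Re z2" (is ?A)
      proof (rule ccontr)
        assume na: "\<not> ?A"
        have s1: "Im z1 = - Im z2" if "Re z1 = Re z2" using R12 that ne' by auto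
        have s3: "Im z3 = Im z2" if "Re z1 = Re z2" "Re z3 = Re z2" using R12 R13 that ne' by auto
        have "(l2 - (if Re z1 = Re z2 then l1 else 0) + (if Re z1 = Re z2 \<and> Re z3 = Re z2 then l3 else 0)) * Im z2 = 0"
          using G[of "Re z2"] s1 s3 n24 na by (auto simp: algebra_simps split: if_splits)
        moreover have "l2 - (if Re z1 = Re z2 then l1 else 0) + (if Re z1 = Re z2 \<and> Re z3 = Re z2 then l3 else 0) > 0"
          using lt lpos by auto
        ultimately show False using s2 by auto
      qed
      then have g: "l2 * Im z2 + l3 * Im z3 = 0"
        using G[of "Re z2"] n24 by auto
      have z32: "Im z3 = - Im z2 \<and> z2 = cnj z3"
      proof (rule ccontr)
        assume "\<not> ?thesis"
        then have "Im z3 = Im z2" using R23 A by auto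
        then have "(l2 + l3) * Im z2 = 0" using g by (simp add: algebra_simps)
        then show False using lpos s2 by auto
      qed
      have "(l2 - l3) * Im z2 = 0"
        using g conjunct1[OF z32] by (simp add: algebra_simps)
      \<comment> \<open>The difference \<open>l2 - l3\<close> simplifies to
        \<open>p - q\<close>.\<close>
      then have "p = q"
        using s2 by (auto simp: l_defs algebra_simps)
      moreover have z44: "z4 * z4 = 1"
        using z4 by auto
      moreover have "(z1 * z4) * z4 = z4"
        using rel conjunct2[OF z32] inv by (simp add: mult_ac)
      then have "z1 = z4"
        using z44 by (simp only: mult.assoc mult_1_right)
      ultimately show ?thesis
        using z4 by auto
    next
      case True
      then have "z2 = 1 \<or> z2 = -1"
        using real[OF unit(2)] by auto
      then have "(z4 * cnj z2) ^ 2 = 1"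
        using z4 by auto
      then show ?thesis by blast
    qed
  qed
qed

section \<open>The circle group\<close>

lemma circ_exp_circ: "circ_exp l (circ t) = cis (of_int l * t)"
proof -
  have "circ_exp l (circ t) = exp (\<i> * of_int l * of_real t)"
    by transfer simp
  then show ?thesis
    by (simp add: cis_conv_exp mult_ac)
qed

lemma circ_zero: "circ 0 = 0"
  by transfer (simp add: circle_rel_def)

lemma circ_minus: "- circ t = circ (- t)"
  using circ_diff[of 0 t] by (simp add: circ_zero)

lemma norm_circ_exp [simp]: "cmod (circ_exp l x) = 1"
  using circ_surj[of x] by (auto simp: circ_exp_circ)

lemma circ_exp_add: "circ_exp l (x + y) = circ_exp l x * circ_exp l y"
  using circ_surj[of x] circ_surj[of y]
  by (auto simp: circ_exp_circ circ_add cis_mult distrib_left)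

lemma circ_exp_uminus: "circ_exp l (- x) = cnj (circ_exp l x)"
  using circ_surj[of x] by (auto simp: circ_exp_circ circ_minus cis_cnj)

lemma circ_exp_diff: "circ_exp l (x - y) = circ_exp l x * cnj (circ_exp l y)"
  using circ_exp_add[of l x "- y"] by (simp add: circ_exp_uminus)

lemma circ_exp_minus_index: "circ_exp (- l) x = cnj (circ_exp l x)"
  using circ_surj[of x] by (auto simp: circ_exp_circ cis_cnj)

lemma circ_exp_of_nat: "circ_exp (int n) x = circ_exp 1 x ^ n"
  using circ_surj[of x] by (auto simp: circ_exp_circ Complex.DeMoivre)

lemma circ_exp_zero_index [simp]: "circ_exp 0 x = 1"
  using circ_surj[of x] by (auto simp: circ_exp_circ)

lemma circ_exp_inject: "circ_exp 1 x = circ_exp 1 y \<longleftrightarrow> x = y"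
proof
  assume eq: "circ_exp 1 x = circ_exp 1 y"
  obtain s t where x: "x = circ s" and y: "y = circ t"
    using circ_surj by metis
  have "sin s = sin t \<and> cos s = cos t"
    using eq by (auto simp: x y circ_exp_circ complex_eq_iff)
  then show "x = y"
    unfolding sin_cos_eq_iff by (auto simp: x y circ_eq_iff algebra_simps)
qed simp

text \<open>The n-fold multiple of the angle is a multiple of the full turn; reducing the multiplier
  modulo \<open>n\<close> changes the angle only by full turns. The cases n = 2 and n = 3 yield the
  excluded differences of angles.\<close>

lemma circle_torsion:
  assumes "circ_exp 1 x ^ n = 1" "n > 0"
  obtains k where "k < n" "x = circ (2 * pi * real k / real n)"
proof -
  obtain t where x: "x = circ t"
    using circ_surj by blast
  have "circ_exp 1 (circ (real n * t)) = circ_exp 1 (circ 0)"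
    using assms by (simp add: x circ_exp_circ Complex.DeMoivre)
  then obtain k :: int where k: "real n * t = 2 * pi * of_int k"
    by (auto simp: circ_exp_inject circ_eq_iff)
  define m where "m = nat (k mod int n)"
  have "real m = of_int (k mod int n)"
    using assms(2) by (simp add: m_def)
  also have "\<dots> = of_int k - real n * of_int (k div int n)"
    by (subst minus_mult_div_eq_mod[symmetric]) simp
  finally have k': "of_int k = real m + real n * of_int (k div int n)"
    by simp
  have "t = 2 * pi * of_int k / real n"
    using k assms(2) by (simp add: field_simps)
  then have "x = circ (2 * pi * real m / real n)"
    using assms(2) unfolding x circ_eq_iff k'
    by (intro exI[of _ "k div int n"]) (simp add: field_simps)
  moreover have "m < n"
    using assms(2) by (simp add: m_def nat_less_iff)
  ultimately show ?thesis
    using that by blast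
qed

section \<open>Topology and Borel structure of the circle\<close>

lemma continuous_on_circle:
  fixes g :: "circle \<Rightarrow> 'b::topological_space"
  assumes "continuous_on UNIV (\<lambda>t. g (circ t))"
  shows "continuous_on UNIV g"
proof -
  have "open (g -` B)" if "open B" for B
  proof -
    have "open ((\<lambda>t. g (circ t)) -` B)"
      using assms that by (simp add: continuous_on_open_vimage)
    \<comment> \<open>The topology is the quotient topology: openness on the circle is openness of
      the preimage under \<open>circ\<close>.\<close>
    then show ?thesis
      by (simp add: open_circle_def vimage_def)
  qed
  then show ?thesis
    by (simp add: continuous_on_open_vimage)
qed

lemma continuous_on_circ_exp [continuous_intros]:
  assumes "continuous_on S g"
  shows "continuous_on S (\<lambda>x. circ_exp l (g x))"
proof -
  have "continuous_on UNIV (circ_exp l)"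
    by (rule continuous_on_circle) (auto simp: circ_exp_circ intro!: continuous_intros)
  then show ?thesis
    using assms by (rule continuous_on_compose2) auto
qed

lemma borel_measurable_circ_exp [measurable]: "circ_exp l \<in> borel_measurable borel"
  by (intro borel_measurable_continuous_onI continuous_intros)

lemma borel_measurable_circ [measurable]: "circ \<in> borel_measurable borel"
  by (rule borel_measurable_continuous_onI[OF continuous_on_circ])

lemma borel_measurable_circle_add [measurable]: "(\<lambda>x :: circle. x + a) \<in> borel_measurable borel"
proof -
  obtain s where a: "a = circ s"
    using circ_surj by blast
  have "continuous_on UNIV (\<lambda>t. circ t + a)"
    unfolding a circ_add
    by (rule continuous_on_compose2[OF continuous_on_circ]) (auto intro!: continuous_intros)
  then show ?thesis
    by (intro borel_measurable_continuous_onI continuous_on_circle)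
qed

lemma borel_measurable_circle_diff [measurable]: "(\<lambda>x :: circle. x - a) \<in> borel_measurable borel"
  using borel_measurable_circle_add[of "- a"] by simp

lemma circ_rep: "- pi < circ_rep x" "circ_rep x \<le> pi" "circ (circ_rep x) = x"
  using theI'[OF ex1_circ_rep[of x]] by (auto simp: circ_rep_def)

text \<open>The representative jumps at \<open>pi\<close>, but its absolute value does not; the
  right-hand side exhibits it as a continuous function of the point.\<close>

lemma abs_circ_rep: "\<bar>circ_rep x\<bar> = arccos (Re (circ_exp 1 x))"
proof -
  have "Re (circ_exp 1 x) = cos \<bar>circ_rep x\<bar>"
    using circ_exp_circ[of 1 "circ_rep x"] by (simp add: circ_rep)
  then show ?thesis
    using circ_rep(1,2)[of x] arccos_cos[of "\<bar>circ_rep x\<bar>"] by simp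
qed

section \<open>Translation invariance of the measure on the circle\<close>

lemma sets_circle_lebesgue [simp, measurable_cong]: "sets circle_lebesgue = sets borel"
  by (simp add: circle_lebesgue_def)

lemma space_circle_lebesgue [simp]: "space circle_lebesgue = UNIV"
  by (simp add: circle_lebesgue_def)

lemma emeasure_circle_lebesgue:
  assumes "A \<in> sets borel"
  shows "emeasure circle_lebesgue A = emeasure lborel (circ -` A \<inter> {- pi<..pi})"
proof -
  have [measurable]: "circ \<in> measurable (restrict_space lborel {- pi<..pi}) borel"
    by (intro measurable_restrict_space1) simp
  show ?thesis
    using assms
    by (simp add: circle_lebesgue_def emeasure_distr space_restrict_space emeasure_restrict_space Int_commute)
qed

lemma emeasure_lborel_translate:
  fixes c :: real
  assumes [measurable]: "B \<in> sets borel"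
  shows "emeasure lborel ((\<lambda>x. c + x) -` B) = emeasure lborel B"
proof -
  have "emeasure lborel B = emeasure (distr lborel borel ((+) c)) B"
    by (simp add: lborel_distr_plus)
  also have "\<dots> = emeasure lborel ((\<lambda>x. c + x) -` B)"
    by (subst emeasure_distr) auto
  finally show ?thesis ..
qed

text \<open>Translation moves the fundamental interval to one ending at \<open>s + pi\<close>. It is
  cut at \<open>pi\<close>, and the part beyond is moved back by a full turn, which does not affect
  the periodic set \<open>B\<close>.\<close>

lemma distr_circle_lebesgue_add: "distr circle_lebesgue borel (\<lambda>x. x + a) = circle_lebesgue"
proof (rule measure_eqI)
  fix A assume "A \<in> sets (distr circle_lebesgue borel (\<lambda>x. x + a))"
  then have A [measurable]: "A \<in> sets borel"
    by simp
  \<comment> \<open>This representative of \<open>a\<close> lies in (0, 2 pi], so the moved interval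
    overshoots only on the right and by at most one period.\<close>
  define s where "s = circ_rep (a - circ pi) + pi"
  have s: "0 \<le> s" "s \<le> 2 * pi"
    using circ_rep[of "a - circ pi"] by (auto simp: s_def)
  have a: "a = circ s"
    by (simp add: s_def circ_rep flip: circ_add)
  define B where "B = circ -` A"
  have [measurable]: "B \<in> sets borel"
    unfolding B_def using measurable_sets[OF borel_measurable_circ A] by simp
  have periodic: "2 * pi + x \<in> B \<longleftrightarrow> x \<in> B" for x
  proof -
    have "circ (2 * pi + x) = circ x"
      by (auto simp: circ_eq_iff intro: exI[of _ 1])
    then show ?thesis by (simp add: B_def)
  qed
  have m1: "(\<lambda>x. x + a) -` A \<in> sets borel"
    using measurable_sets[OF borel_measurable_circle_add A] by simp
  have "emeasure (distr circle_lebesgue borel (\<lambda>x. x + a)) A = emeasure circle_lebesgue ((\<lambda>x. x + a) -` A)"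
    by (subst emeasure_distr) auto
  also have "\<dots> = emeasure lborel ((\<lambda>x. s + x) -` (B \<inter> {s - pi<..s + pi}))"
    by (subst emeasure_circle_lebesgue[OF m1])
       (rule arg_cong[where f = "emeasure lborel"], auto simp: B_def a circ_add add_ac)
  also have "\<dots> = emeasure lborel (B \<inter> {s - pi<..s + pi})"
    by (rule emeasure_lborel_translate) simp
  also have "B \<inter> {s - pi<..s + pi} = (B \<inter> {s - pi<..pi}) \<union> (B \<inter> {pi<..s + pi})"
    using s by auto
  also have "emeasure lborel \<dots> = emeasure lborel (B \<inter> {s - pi<..pi}) + emeasure lborel (B \<inter> {pi<..s + pi})"
    by (subst plus_emeasure) auto
  also have "emeasure lborel (B \<inter> {pi<..s + pi}) =
      emeasure lborel ((\<lambda>x. 2 * pi + x) -` (B \<inter> {pi<..s + pi}))"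
    by (rule emeasure_lborel_translate[symmetric]) simp
  also have "(\<lambda>x. 2 * pi + x) -` (B \<inter> {pi<..s + pi}) = B \<inter> {- pi<..s - pi}"
    by (auto simp: periodic)
  also have "emeasure lborel (B \<inter> {s - pi<..pi}) + emeasure lborel (B \<inter> {- pi<..s - pi}) =
      emeasure lborel ((B \<inter> {s - pi<..pi}) \<union> (B \<inter> {- pi<..s - pi}))"
    by (subst plus_emeasure) auto
  also have "(B \<inter> {s - pi<..pi}) \<union> (B \<inter> {- pi<..s - pi}) = B \<inter> {- pi<..pi}"
    using s by auto
  also have "emeasure lborel \<dots> = emeasure circle_lebesgue A"
    by (simp add: emeasure_circle_lebesgue B_def)
  finally show "emeasure (distr circle_lebesgue borel (\<lambda>x. x + a)) A = emeasure circle_lebesgue A" .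
qed simp

section \<open>Identifiability and the limit contrast\<close>

lemma cnj_mix_fourier:
  "cnj (mix_fourier l (p, \<alpha>, \<beta>)) = of_real p * circ_exp l \<alpha> + of_real (1 - p) * circ_exp l \<beta>"
  by (simp add: circ_exp_minus_index)

text \<open>Expanding the product gives a combination of the four differences of angles, to which
  \<open>four_unit_complex_rigidity\<close> applies. Its first two outcomes make \<beta> - \<alpha>
  a torsion element of order dividing 3 or 2, which admissibility forbids; the third leaves equality
  or a shift by half a turn.\<close>

lemma mix_fourier_identifiable:
  assumes adm: "\<theta> \<in> admissible" "\<theta>' \<in> admissible"
    and eq: "\<And>l. l \<in> {1, 2, 3, 4} \<Longrightarrow> Im (mix_fourier l \<theta> * cnj (mix_fourier l \<theta>')) = 0"
  shows "\<theta> = \<theta>' \<or> \<theta> = shift_pi \<theta>'"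
proof -
  obtain p \<alpha> \<beta> where \<theta>: "\<theta> = (p, \<alpha>, \<beta>)" by (cases \<theta>)
  obtain q \<alpha>' \<beta>' where \<theta>': "\<theta>' = (q, \<alpha>', \<beta>')" by (cases \<theta>')
  have p: "0 < p" "p < 1/2" and q: "0 < q" "q < 1/2"
    and ne: "\<beta> - \<alpha> \<noteq> 0" "\<beta>' - \<alpha>' \<noteq> 0"
    and adm': "\<beta> - \<alpha> \<notin> {circ (- (2 * pi / 3)), circ 0, circ (2 * pi / 3), circ pi}"
    using adm by (auto simp: admissible_def \<theta> \<theta>' circ_zero)
  define z where "z x = circ_exp 1 x" for x
  have eq': "p * q * Im (z (\<alpha> - \<alpha>') ^ l) + p * (1 - q) * Im (z (\<alpha> - \<beta>') ^ l) +
      (1 - p) * q * Im (z (\<beta> - \<alpha>') ^ l) + (1 - p) * (1 - q) * Im (z (\<beta> - \<beta>') ^ l) = 0"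
    if "l \<in> {1,2,3,4}" for l :: nat
  proof -
    have "int l \<in> {1,2,3,4}"
      using that by auto
    \<comment> \<open>Conjugation turns the exponents \<open>- l\<close> of
      \<open>mix_fourier\<close> into \<open>l\<close>, at the cost of a sign that is irrelevant for
      vanishing.\<close>
    from eq[OF this] have "Im (cnj (mix_fourier l \<theta> * cnj (mix_fourier l \<theta>'))) = 0"
      by simp
    also have "cnj (mix_fourier l \<theta> * cnj (mix_fourier l \<theta>')) =
        cnj (mix_fourier l \<theta>) * mix_fourier l \<theta>'"
      by simp
    also have "\<dots> =
        of_real (p * q) * circ_exp l (\<alpha> - \<alpha>') + of_real (p * (1 - q)) * circ_exp l (\<alpha> - \<beta>') +
        of_real ((1 - p) * q) * circ_exp l (\<beta> - \<alpha>') + of_real ((1 - p) * (1 - q)) * circ_exp l (\<beta> - \<beta>')"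
      unfolding \<theta> \<theta>' cnj_mix_fourier
      by (simp add: circ_exp_minus_index circ_exp_diff algebra_simps)
    finally show ?thesis
      by (simp add: z_def circ_exp_of_nat)
  qed
  have unit: "cmod (z x) = 1" for x
    by (simp add: z_def)
  have rel: "z (\<alpha> - \<alpha>') * z (\<beta> - \<beta>') = z (\<alpha> - \<beta>') * z (\<beta> - \<alpha>')"
    by (simp add: z_def circ_exp_diff)
  have ne': "z (\<beta> - \<beta>') \<noteq> z (\<alpha> - \<beta>')" "z (\<beta> - \<beta>') \<noteq> z (\<beta> - \<alpha>')"
    using ne by (auto simp: z_def circ_exp_inject)
  have diff: "z (\<beta> - \<beta>') * cnj (z (\<alpha> - \<beta>')) = circ_exp 1 (\<beta> - \<alpha>)"
    by (simp add: z_def flip: circ_exp_diff)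
  have "(z (\<beta> - \<beta>') * cnj (z (\<alpha> - \<beta>'))) ^ 3 = 1 \<or> (z (\<beta> - \<beta>') * cnj (z (\<alpha> - \<beta>'))) ^ 2 = 1 \<or>
      p = q \<and> z (\<alpha> - \<alpha>') = z (\<beta> - \<beta>') \<and> (z (\<beta> - \<beta>'))\<^sup>2 = 1"
    by (rule four_unit_complex_rigidity[OF unit unit unit unit rel ne' p q eq'])
  then consider (three) "circ_exp 1 (\<beta> - \<alpha>) ^ 3 = 1" | (two) "circ_exp 1 (\<beta> - \<alpha>) ^ 2 = 1"
    | (same) "p = q" "\<alpha> - \<alpha>' = \<beta> - \<beta>'" "circ_exp 1 (\<beta> - \<beta>') ^ 2 = 1"
    unfolding diff by (auto simp: z_def circ_exp_inject)
  then show ?thesis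
  proof cases
    case three
    then obtain k where k: "k < 3" "\<beta> - \<alpha> = circ (2 * pi * real k / real 3)"
      using circle_torsion[of "\<beta> - \<alpha>" 3] by auto
    \<comment> \<open>The case \<open>k = 2\<close> appears in \<open>admissible\<close> with its
      negative representative.\<close>
    have "circ (4 * pi / 3) = circ (- (2 * pi / 3))"
      unfolding circ_eq_iff by (rule exI[of _ 1]) simp
    moreover have "k = 0 \<or> k = 1 \<or> k = 2"
      using k(1) by auto
    ultimately have False
      using adm' k(2) by auto
    then show ?thesis ..
  next
    case two
    then obtain k where k: "k < 2" "\<beta> - \<alpha> = circ (2 * pi * real k / real 2)"
      using circle_torsion[of "\<beta> - \<alpha>" 2] by auto
    moreover have "k = 0 \<or> k = 1"
      using k(1) by auto
    ultimately have False
      using adm' k(2) by auto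
    then show ?thesis ..
  next
    case same
    then obtain k where k: "k < 2" "\<beta> - \<beta>' = circ (2 * pi * real k / real 2)"
      using circle_torsion[of "\<beta> - \<beta>'" 2] by auto
    moreover have "k = 0 \<or> k = 1"
      using k(1) by auto
    ultimately have "\<beta> - \<beta>' = 0 \<or> \<beta> - \<beta>' = circ pi"
      by (auto simp: circ_zero)
    then show ?thesis
      using same(1,2) by (auto simp: \<theta> \<theta>' algebra_simps)
  qed
qed

section \<open>Moments of the mixture density\<close>

lemma integrable_circle_lebesgue_diff:
  fixes F :: "circle \<Rightarrow> 'a::{banach, second_countable_topology}"
  assumes "integrable circle_lebesgue F"
  shows "integrable circle_lebesgue (\<lambda>x. F (x - a))"
proof -
  have "integrable (distr circle_lebesgue borel (\<lambda>x. x - a)) F"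
    using assms distr_circle_lebesgue_add[of "- a"] by simp
  then show ?thesis
    by (rule integrable_distr[rotated]) simp
qed

lemma integral_circle_lebesgue_diff:
  fixes F :: "circle \<Rightarrow> 'a::{banach, second_countable_topology}"
  assumes "F \<in> borel_measurable borel"
  shows "(LINT x|circle_lebesgue. F (x - a)) = (LINT x|circle_lebesgue. F x)"
proof -
  have "(LINT x|circle_lebesgue. F x) = (LINT x|distr circle_lebesgue borel (\<lambda>x. x - a). F x)"
    using distr_circle_lebesgue_add[of "- a"] by simp
  also have "\<dots> = (LINT x|circle_lebesgue. F (x - a))"
    using assms by (intro integral_distr) simp_all
  finally show ?thesis ..
qed

lemma integrable_circ_exp:
  assumes "integrable circle_lebesgue f"
  shows "integrable circle_lebesgue (\<lambda>x. f x *\<^sub>R circ_exp l x)"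
proof (rule Bochner_Integration.integrable_bound[OF assms])
  have [measurable]: "f \<in> borel_measurable borel"
    using borel_measurable_integrable[OF assms] by simp
  show "(\<lambda>x. f x *\<^sub>R circ_exp l x) \<in> borel_measurable circle_lebesgue"
    by simp
qed auto

text \<open>Translating by \<open>a\<close> multiplies the \<open>l\<close>-th moment by
  \<open>circ_exp l a\<close>. The conjugate arises because \<open>mix_fourier\<close> carries the
  opposite exponent.\<close>

lemma integral_mixture_circ_exp:
  assumes "circle_density f"
  shows "(LINT x|circle_lebesgue. mixture f \<theta> x *\<^sub>R circ_exp l x) =
    (LINT x|circle_lebesgue. f x *\<^sub>R circ_exp l x) * cnj (mix_fourier l \<theta>)"
proof -
  obtain p \<alpha> \<beta> where \<theta>: "\<theta> = (p, \<alpha>, \<beta>)" by (cases \<theta>)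
  have int: "integrable circle_lebesgue f" and [measurable]: "f \<in> borel_measurable borel"
    using assms by (auto simp: circle_density_def)
  have I: "integrable circle_lebesgue (\<lambda>x. f (x - a) *\<^sub>R circ_exp l x)" for a
    by (intro integrable_circ_exp integrable_circle_lebesgue_diff int)
  have shift: "(LINT x|circle_lebesgue. f (x - a) *\<^sub>R circ_exp l x) =
      (LINT x|circle_lebesgue. f x *\<^sub>R circ_exp l x) * circ_exp l a" for a
  proof -
    have "(LINT x|circle_lebesgue. f (x - a) *\<^sub>R circ_exp l x) =
        (LINT x|circle_lebesgue. f (x - a) *\<^sub>R circ_exp l (x - a + a))"
      by simp
    also have "\<dots> = (LINT x|circle_lebesgue. f x *\<^sub>R circ_exp l (x + a))"
      by (rule integral_circle_lebesgue_diff[where F = "\<lambda>x. f x *\<^sub>R circ_exp l (x + a)"]) measurable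
    also have "\<dots> = (LINT x|circle_lebesgue. (f x *\<^sub>R circ_exp l x) * circ_exp l a)"
      by (simp add: circ_exp_add)
    finally show ?thesis
      by (simp only: integral_mult_left_zero)
  qed
  have "(LINT x|circle_lebesgue. mixture f \<theta> x *\<^sub>R circ_exp l x) =
      (LINT x|circle_lebesgue. p *\<^sub>R (f (x - \<alpha>) *\<^sub>R circ_exp l x) +
        (1 - p) *\<^sub>R (f (x - \<beta>) *\<^sub>R circ_exp l x))"
    by (simp add: \<theta> scaleR_add_left mult.assoc)
  also have "\<dots> = p *\<^sub>R (LINT x|circle_lebesgue. f (x - \<alpha>) *\<^sub>R circ_exp l x) +
      (1 - p) *\<^sub>R (LINT x|circle_lebesgue. f (x - \<beta>) *\<^sub>R circ_exp l x)"
    by (subst Bochner_Integration.integral_add)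
       (simp_all only: I integrable_scaleR_right integral_scaleR_right)
  also have "\<dots> = (LINT x|circle_lebesgue. f x *\<^sub>R circ_exp l x) * cnj (mix_fourier l \<theta>)"
    unfolding \<theta> cnj_mix_fourier shift by (simp only: scaleR_conv_of_real distrib_left mult_ac)
  finally show ?thesis .
qed

lemma norm_mix_fourier_le:
  assumes "\<theta> \<in> admissible"
  shows "cmod (mix_fourier l \<theta>) \<le> 1"
proof -
  obtain p \<alpha> \<beta> where \<theta>: "\<theta> = (p, \<alpha>, \<beta>)" by (cases \<theta>)
  have p: "0 < p" "p < 1/2"
    using assms by (auto simp: admissible_def \<theta>)
  have "cmod (mix_fourier l \<theta>) \<le>
      cmod (of_real p * circ_exp (- l) \<alpha>) + cmod (of_real (1 - p) * circ_exp (- l) \<beta>)"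
    unfolding \<theta> mix_fourier.simps by (rule norm_triangle_ineq)
  also have "\<dots> = 1"
    using p by (simp add: norm_mult del: of_real_diff)
  finally show ?thesis .
qed

lemma continuous_on_mix_fourier: "continuous_on UNIV (mix_fourier l)"
proof -
  have "mix_fourier l = (\<lambda>\<theta>. of_real (fst \<theta>) * circ_exp (- l) (fst (snd \<theta>)) +
      of_real (1 - fst \<theta>) * circ_exp (- l) (snd (snd \<theta>)))"
    by (auto simp: fun_eq_iff)
  then show ?thesis
    by (auto intro!: continuous_intros)
qed

text \<open>Only squares of the representatives enter the Euclidean norm, so their jump at
  \<open>pi\<close> disappears. This makes sets defined by weak inequalities on the distance
  closed.\<close>

lemma continuous_on_norm_param_diff: "continuous_on UNIV (\<lambda>\<theta>. norm (param_diff \<theta> \<theta>'))"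
proof -
  obtain q \<alpha>' \<beta>' where \<theta>': "\<theta>' = (q, \<alpha>', \<beta>')" by (cases \<theta>')
  have *: "(circ_rep x)\<^sup>2 = (arccos (Re (circ_exp 1 x)))\<^sup>2" for x
    by (simp flip: abs_circ_rep)
  have eq: "(\<lambda>\<theta>. norm (param_diff \<theta> \<theta>')) = (\<lambda>\<theta>. sqrt ((fst \<theta> - q)\<^sup>2 +
      ((arccos (Re (circ_exp 1 (fst (snd \<theta>)) * cnj (circ_exp 1 \<alpha>'))))\<^sup>2 +
       (arccos (Re (circ_exp 1 (snd (snd \<theta>)) * cnj (circ_exp 1 \<beta>'))))\<^sup>2)))"
    by (auto simp: fun_eq_iff \<theta>' norm_prod_def * simp flip: circ_exp_diff)
  have "- 1 \<le> Re (circ_exp 1 x * cnj (circ_exp 1 y)) \<and> Re (circ_exp 1 x * cnj (circ_exp 1 y)) \<le> 1" for x y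
    using abs_Re_le_cmod[of "circ_exp 1 x * cnj (circ_exp 1 y)"]
    by (simp add: norm_mult abs_le_iff minus_le_iff del: times_complex.sel)
  then show ?thesis
    unfolding eq by (auto intro!: continuous_intros simp del: times_complex.sel)
qed

section \<open>The empirical contrast and its uniform approximation\<close>

lemma sum_off_diagonal:
  fixes Y :: "'i \<Rightarrow> 'a::comm_ring_1"
  assumes "finite A"
  shows "(\<Sum>(k, j)\<in>{(k, j). k \<in> A \<and> j \<in> A \<and> k \<noteq> j}. Y k * Y j) = (\<Sum>k\<in>A. Y k)\<^sup>2 - (\<Sum>k\<in>A. (Y k)\<^sup>2)"
proof -
  \<comment> \<open>The full square minus the diagonal: for the sample, this trades the double sum
    of the contrast for the square of an empirical mean and a correction with only \<open>n\<close>
    terms.\<close>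
  have set: "{(k, j). k \<in> A \<and> j \<in> A \<and> k \<noteq> j} = A \<times> A - (\<lambda>k. (k, k)) ` A"
    by auto
  have "(\<Sum>(k, j)\<in>A \<times> A - (\<lambda>k. (k, k)) ` A. Y k * Y j) =
      (\<Sum>(k, j)\<in>A \<times> A. Y k * Y j) - (\<Sum>(k, j)\<in>(\<lambda>k. (k, k)) ` A. Y k * Y j)"
    using assms by (intro sum_diff) auto
  also have "(\<Sum>(k, j)\<in>(\<lambda>k. (k, k)) ` A. Y k * Y j) = (\<Sum>k\<in>A. (Y k)\<^sup>2)"
    by (subst sum.reindex) (auto simp: inj_on_def power2_eq_square)
  also have "(\<Sum>(k, j)\<in>A \<times> A. Y k * Y j) = (\<Sum>k\<in>A. Y k)\<^sup>2"
    by (simp add: power2_eq_square sum_product sum.cartesian_product)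
  finally show ?thesis
    unfolding set .
qed

text \<open>The empirical characteristic function: unlike \<open>fourier_coeff\<close> it has
  exponent \<open>+ l\<close> and no factor 1/(2 pi), matching the exponentials in
  \<open>contrast\<close>.\<close>

definition empirical_coeff :: "nat \<Rightarrow> (nat \<Rightarrow> circle) \<Rightarrow> int \<Rightarrow> complex" where
  "empirical_coeff n x l = (\<Sum>k=1..n. circ_exp l (x k)) / of_nat n"

lemma contrast_eq:
  assumes "n \<ge> 2"
  shows "contrast n x \<theta> = real n / (4 * pi\<^sup>2 * (real n - 1)) *
    (\<Sum>l=-4..4. (Im (empirical_coeff n x l * mix_fourier l \<theta>))\<^sup>2 -
      (\<Sum>k=1..n. (Im (circ_exp l (x k) * mix_fourier l \<theta>))\<^sup>2) / (real n)\<^sup>2)"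
proof -
  have sum: "(\<Sum>k=1..n. Im (circ_exp l (x k) * mix_fourier l \<theta>)) =
      real n * Im (empirical_coeff n x l * mix_fourier l \<theta>)" for l
  proof -
    have "(\<Sum>k=1..n. circ_exp l (x k) * mix_fourier l \<theta>) =
        real n *\<^sub>R (empirical_coeff n x l * mix_fourier l \<theta>)"
      using assms by (simp add: empirical_coeff_def sum_distrib_right scaleR_conv_of_real)
    then have "Im (\<Sum>k=1..n. circ_exp l (x k) * mix_fourier l \<theta>) =
        Im (real n *\<^sub>R (empirical_coeff n x l * mix_fourier l \<theta>))"
      by (rule arg_cong)
    then show ?thesis
      unfolding Im_sum scaleR_complex.sel .
  qed
  have "(\<Sum>l=-4..4. \<Sum>(k, j)\<in>{(k, j). k \<in> {1..n} \<and> j \<in> {1..n} \<and> k \<noteq> j}.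
        Im (circ_exp l (x k) * mix_fourier l \<theta>) * Im (circ_exp l (x j) * mix_fourier l \<theta>)) =
      (\<Sum>l=-4..4. (real n)\<^sup>2 * ((Im (empirical_coeff n x l * mix_fourier l \<theta>))\<^sup>2 -
      (\<Sum>k=1..n. (Im (circ_exp l (x k) * mix_fourier l \<theta>))\<^sup>2) / (real n)\<^sup>2))"
    using assms
    by (intro sum.cong refl) (subst sum_off_diagonal, simp, subst sum, simp add: power_mult_distrib right_diff_distrib)
  then show ?thesis
    using assms unfolding contrast_def sum_distrib_left[symmetric]
    by (simp add: power2_eq_square)
qed

text \<open>The moments \<open>m\<close> are left as a parameter, so that the deterministic
  comparison with the empirical contrast needs only the bound
  \<open>cmod (m l) \<le> 1\<close>.\<close>

definition limit_contrast :: "(int \<Rightarrow> complex) \<Rightarrow> param \<Rightarrow> real" where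
  "limit_contrast m \<theta> = (\<Sum>l=-4..4. (Im (m l * mix_fourier l \<theta>))\<^sup>2)"

lemma continuous_on_limit_contrast: "continuous_on UNIV (limit_contrast m)"
  unfolding limit_contrast_def[abs_def]
  by (intro continuous_intros continuous_on_mix_fourier)

lemma norm_empirical_coeff_le: "cmod (empirical_coeff n x l) \<le> 1"
proof -
  have "cmod (\<Sum>k=1..n. circ_exp l (x k)) \<le> real n"
    by (rule order.trans[OF norm_sum]) simp
  then show ?thesis
    by (auto simp: empirical_coeff_def norm_divide divide_le_eq)
qed

lemma abs_power2_diff_le:
  fixes a b :: real
  assumes "\<bar>a\<bar> \<le> 1" "\<bar>b\<bar> \<le> 1"
  shows "\<bar>a\<^sup>2 - b\<^sup>2\<bar> \<le> 2 * \<bar>a - b\<bar>"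
proof -
  have "\<bar>a\<^sup>2 - b\<^sup>2\<bar> = \<bar>a + b\<bar> * \<bar>a - b\<bar>"
    by (simp add: power2_eq_square square_diff_square_factored abs_mult)
  also have "\<dots> \<le> 2 * \<bar>a - b\<bar>"
    using assms by (intro mult_right_mono) auto
  finally show ?thesis .
qed

lemma abs_Im_mult_le:
  assumes "cmod z \<le> 1"
  shows "\<bar>Im (w * z)\<bar> \<le> cmod w"
proof -
  have "\<bar>Im (w * z)\<bar> \<le> cmod (w * z)"
    by (rule abs_Im_le_cmod)
  also have "\<dots> \<le> cmod w * 1"
    unfolding norm_mult using assms by (intro mult_left_mono) auto
  finally show ?thesis by simp
qed

text \<open>Squaring is 2-Lipschitz on [-1, 1] and the mixture coefficients lie in the unit disc,
  whence the first error term. The diagonal costs at most 1/n for each of the nine frequencies. The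
  bound is uniform in \<theta>.\<close>

lemma contrast_close_to_limit:
  assumes "n \<ge> 2" "\<theta> \<in> admissible" and m: "\<And>l. cmod (m l) \<le> 1"
  shows "\<bar>4 * pi\<^sup>2 * (real n - 1) / real n * contrast n x \<theta> - limit_contrast m \<theta>\<bar> \<le>
    2 * (\<Sum>l=-4..4. cmod (empirical_coeff n x l - m l)) + 9 / real n"
proof -
  let ?M = "\<lambda>l. mix_fourier l \<theta>"
  define R where "R l = (\<Sum>k=1..n. (Im (circ_exp l (x k) * ?M l))\<^sup>2) / (real n)\<^sup>2" for l
  have M: "cmod (?M l) \<le> 1" for l
    using assms(2) by (rule norm_mix_fourier_le)
  have "4 * pi\<^sup>2 * (real n - 1) / real n * contrast n x \<theta> =
      (\<Sum>l=-4..4. (Im (empirical_coeff n x l * ?M l))\<^sup>2 - R l)"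
    unfolding contrast_eq[OF assms(1)] R_def using assms(1) by simp
  then have "\<bar>4 * pi\<^sup>2 * (real n - 1) / real n * contrast n x \<theta> - limit_contrast m \<theta>\<bar> =
      \<bar>\<Sum>l=-4..4. ((Im (empirical_coeff n x l * ?M l))\<^sup>2 - (Im (m l * ?M l))\<^sup>2) - R l\<bar>"
    by (simp only: limit_contrast_def flip: sum_subtractf) (simp add: algebra_simps)
  also have "\<dots> \<le> (\<Sum>l=-4..4. \<bar>((Im (empirical_coeff n x l * ?M l))\<^sup>2 - (Im (m l * ?M l))\<^sup>2) - R l\<bar>)"
    by (rule sum_abs)
  also have "\<dots> \<le> (\<Sum>l=(-4::int)..4. 2 * cmod (empirical_coeff n x l - m l) + 1 / real n)"
  proof (rule sum_mono)
    fix l :: int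
    have "\<bar>(Im (empirical_coeff n x l * ?M l))\<^sup>2 - (Im (m l * ?M l))\<^sup>2\<bar> \<le>
        2 * \<bar>Im (empirical_coeff n x l * ?M l) - Im (m l * ?M l)\<bar>"
      using abs_Im_mult_le[OF M, of "empirical_coeff n x l" l] abs_Im_mult_le[OF M, of "m l" l]
        m[of l] norm_empirical_coeff_le[of n x l]
      by (intro abs_power2_diff_le) linarith+
    also have "Im (empirical_coeff n x l * ?M l) - Im (m l * ?M l) =
        Im ((empirical_coeff n x l - m l) * ?M l)"
      by (simp add: algebra_simps)
    also have "\<bar>\<dots>\<bar> \<le> cmod (empirical_coeff n x l - m l)"
      by (rule abs_Im_mult_le[OF M])
    finally have "\<bar>(Im (empirical_coeff n x l * ?M l))\<^sup>2 - (Im (m l * ?M l))\<^sup>2\<bar> \<le>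
        2 * cmod (empirical_coeff n x l - m l)"
      by simp
    moreover have "0 \<le> R l"
      unfolding R_def by (intro divide_nonneg_nonneg sum_nonneg) auto
    moreover have "R l \<le> 1 / real n"
    proof -
      have "(Im (circ_exp l (x k) * ?M l))\<^sup>2 \<le> 1" for k
        using abs_Im_mult_le[OF M, of "circ_exp l (x k)" l] by (simp add: abs_square_le_1)
      then have "(\<Sum>k=1..n. (Im (circ_exp l (x k) * ?M l))\<^sup>2) \<le> real n"
        using sum_bounded_above[of "{1..n}" "\<lambda>k. (Im (circ_exp l (x k) * ?M l))\<^sup>2" 1] by simp
      then have "R l \<le> real n / (real n)\<^sup>2"
        unfolding R_def by (intro divide_right_mono) auto
      then show ?thesis
        using assms(1) by (simp add: power2_eq_square)
    qed
    ultimately show "\<bar>((Im (empirical_coeff n x l * ?M l))\<^sup>2 - (Im (m l * ?M l))\<^sup>2) - R l\<bar> \<le>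
        2 * cmod (empirical_coeff n x l - m l) + 1 / real n"
      by linarith
  qed
  also have "\<dots> = 2 * (\<Sum>l=-4..4. cmod (empirical_coeff n x l - m l)) + 9 / real n"
    by (simp add: sum.distrib sum_distrib_left)
  finally show ?thesis .
qed

text \<open>The usual comparison for minimisers: the uniform error is paid twice, once at \<theta>
  and once at \<open>\<theta>\<^sub>0\<close>. The rescaling by \<open>c\<close> is nonnegative and
  independent of the parameter, so it preserves the inequality between the two contrasts.\<close>

lemma limit_contrast_arg_min_le:
  assumes "n \<ge> 2" "\<Theta> \<subseteq> admissible" "\<theta>\<^sub>0 \<in> \<Theta>" and m: "\<And>l. cmod (m l) \<le> 1"
    and min: "is_arg_min (contrast n x) (\<lambda>\<theta>. \<theta> \<in> \<Theta>) \<theta>"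
  shows "limit_contrast m \<theta> \<le> limit_contrast m \<theta>\<^sub>0 +
    4 * (\<Sum>l=-4..4. cmod (empirical_coeff n x l - m l)) + 18 / real n"
proof -
  define c where "c = 4 * pi\<^sup>2 * (real n - 1) / real n"
  have "\<theta> \<in> \<Theta>" "contrast n x \<theta> \<le> contrast n x \<theta>\<^sub>0"
    using min assms(3) unfolding is_arg_min_linorder by blast+
  then have "c * contrast n x \<theta> \<le> c * contrast n x \<theta>\<^sub>0"
    using assms(1) by (intro mult_left_mono) (auto simp: c_def)
  moreover have "\<theta> \<in> admissible" "\<theta>\<^sub>0 \<in> admissible"
    using \<open>\<theta> \<in> \<Theta>\<close> assms(2,3) by auto
  then have "\<bar>c * contrast n x \<theta> - limit_contrast m \<theta>\<bar> \<le>
      2 * (\<Sum>l=-4..4. cmod (empirical_coeff n x l - m l)) + 9 / real n"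
    and "\<bar>c * contrast n x \<theta>\<^sub>0 - limit_contrast m \<theta>\<^sub>0\<bar> \<le>
      2 * (\<Sum>l=-4..4. cmod (empirical_coeff n x l - m l)) + 9 / real n"
    by (simp_all only: c_def contrast_close_to_limit[OF assms(1) _ m])
  moreover have "18 / real n = 9 / real n + 9 / real n"
    by simp
  ultimately show ?thesis
    by linarith
qed

section \<open>Consistency\<close>

lemma (in prob_space) weak_law_bounded:
  fixes Y :: "nat \<Rightarrow> 'a \<Rightarrow> real"
  assumes indep: "indep_vars (\<lambda>_. borel) Y {1..}"
    and bound: "\<And>k x. k \<ge> 1 \<Longrightarrow> x \<in> space M \<Longrightarrow> \<bar>Y k x\<bar> \<le> 1"
    and mean: "\<And>k. k \<ge> 1 \<Longrightarrow> expectation (Y k) = \<mu>"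
    and "\<delta> > 0"
  shows "(\<lambda>n. prob {x \<in> space M. \<delta> \<le> \<bar>(\<Sum>k=1..n. Y k x) / real n - \<mu>\<bar>}) \<longlonglongrightarrow> 0"
proof (rule tendsto_sandwich[where f = "\<lambda>_. 0" and h = "\<lambda>n. 2 * exp (- (\<delta>\<^sup>2 / 2) * real n)"])
  show "\<forall>\<^sub>F n in sequentially. prob {x \<in> space M. \<delta> \<le> \<bar>(\<Sum>k=1..n. Y k x) / real n - \<mu>\<bar>} \<le>
      2 * exp (- (\<delta>\<^sup>2 / 2) * real n)"
    using eventually_ge_at_top[of 1]
  proof eventually_elim
    case (elim n)
    interpret Hoeffding_ineq M "{1..n}" Y "\<lambda>_. - 1" "\<lambda>_. 1" "\<Sum>k=1..n. expectation (Y k)"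
      by unfold_locales (use bound in \<open>auto intro!: indep_vars_subset[OF indep] AE_I2 simp: abs_le_iff minus_le_iff\<close>)
    have "prob {x \<in> space M. \<bar>(\<Sum>k=1..n. Y k x) - (\<Sum>k=1..n. expectation (Y k))\<bar> \<ge> real n * \<delta>} \<le>
        2 * exp (-2 * (real n * \<delta>)\<^sup>2 / (\<Sum>k=1..n. (1 - (- 1))\<^sup>2))"
      using \<open>\<delta> > 0\<close> elim by (intro Hoeffding_ineq_abs_ge) auto
    \<comment> \<open>Each variable ranges over an interval of length 2, so the denominator is 4 n
      and the exponent is linear in \<open>n\<close>.\<close>
    also have "-2 * (real n * \<delta>)\<^sup>2 / (\<Sum>k=1..n. (1 - (- 1))\<^sup>2) = - (\<delta>\<^sup>2 / 2) * real n"
      using elim by (simp add: power2_eq_square)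
    also have "(\<Sum>k=1..n. expectation (Y k)) = real n * \<mu>"
      by (simp add: mean)
    also have "{x \<in> space M. \<bar>(\<Sum>k=1..n. Y k x) - real n * \<mu>\<bar> \<ge> real n * \<delta>} =
        {x \<in> space M. \<delta> \<le> \<bar>(\<Sum>k=1..n. Y k x) / real n - \<mu>\<bar>}"
    proof -
      have "real n * \<delta> \<le> \<bar>s - real n * \<mu>\<bar> \<longleftrightarrow> \<delta> \<le> \<bar>s / real n - \<mu>\<bar>" for s
      proof -
        have "s - real n * \<mu> = real n * (s / real n - \<mu>)"
          using elim by (simp add: right_diff_distrib)
        then have "\<bar>s - real n * \<mu>\<bar> = real n * \<bar>s / real n - \<mu>\<bar>"
          by (simp only: abs_mult abs_of_nat)
        then show ?thesis
          using elim by simp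
      qed
      then show ?thesis by simp
    qed
    finally show ?case .
  qed
  show "(\<lambda>n. 2 * exp (- (\<delta>\<^sup>2 / 2) * real n)) \<longlonglongrightarrow> 0"
    using \<open>\<delta> > 0\<close> by real_asymp
qed auto

text \<open>The modulus is at most the sum of the absolute real and imaginary parts, so a deviation
  of \<delta> forces one of \<delta>/2 in a part; each part obeys the bounded weak law.\<close>

lemma (in prob_space) prob_empirical_coeff_deviation:
  assumes indep: "indep_vars (\<lambda>_. borel) X {1..}"
    and mean: "\<And>k. k \<ge> 1 \<Longrightarrow> expectation (\<lambda>\<omega>. circ_exp l (X k \<omega>)) = \<mu>"
    and "\<delta> > 0"
  shows "(\<lambda>n. prob {\<omega> \<in> space M. \<delta> \<le> cmod (empirical_coeff n (\<lambda>k. X k \<omega>) l - \<mu>)}) \<longlonglongrightarrow> 0"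
proof -
  have X [measurable]: "X k \<in> borel_measurable M" if "k \<ge> 1" for k
    using indep that by (auto simp: indep_vars_def)
  have X' [measurable]: "X k \<in> borel_measurable M" if "k \<in> {1..n}" for k n
    using X that by simp
  have int: "integrable M (\<lambda>\<omega>. circ_exp l (X k \<omega>))" if "k \<ge> 1" for k
    using X[OF that] by (intro integrable_const_bound[where B = 1]) auto
  let ?R = "\<lambda>n. {\<omega> \<in> space M. \<delta> / 2 \<le> \<bar>(\<Sum>k=1..n. Re (circ_exp l (X k \<omega>))) / real n - Re \<mu>\<bar>}"
  let ?I = "\<lambda>n. {\<omega> \<in> space M. \<delta> / 2 \<le> \<bar>(\<Sum>k=1..n. Im (circ_exp l (X k \<omega>))) / real n - Im \<mu>\<bar>}"
  have "(\<lambda>n. prob (?R n)) \<longlonglongrightarrow> 0"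
  proof (rule weak_law_bounded)
    show "indep_vars (\<lambda>_. borel) (\<lambda>k \<omega>. Re (circ_exp l (X k \<omega>))) {1..}"
      by (rule indep_vars_compose2[OF indep]) measurable
    show "\<bar>Re (circ_exp l (X k \<omega>))\<bar> \<le> 1" for k \<omega>
      using abs_Re_le_cmod[of "circ_exp l (X k \<omega>)"] by simp
    show "expectation (\<lambda>\<omega>. Re (circ_exp l (X k \<omega>))) = Re \<mu>" if "k \<ge> 1" for k
      using mean[OF that] integral_Re[OF int[OF that]] by simp
  qed (use \<open>\<delta> > 0\<close> in simp)
  moreover have "(\<lambda>n. prob (?I n)) \<longlonglongrightarrow> 0"
  proof (rule weak_law_bounded)
    show "indep_vars (\<lambda>_. borel) (\<lambda>k \<omega>. Im (circ_exp l (X k \<omega>))) {1..}"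
      by (rule indep_vars_compose2[OF indep]) measurable
    show "\<bar>Im (circ_exp l (X k \<omega>))\<bar> \<le> 1" for k \<omega>
      using abs_Im_le_cmod[of "circ_exp l (X k \<omega>)"] by simp
    show "expectation (\<lambda>\<omega>. Im (circ_exp l (X k \<omega>))) = Im \<mu>" if "k \<ge> 1" for k
      using mean[OF that] integral_Im[OF int[OF that]] by simp
  qed (use \<open>\<delta> > 0\<close> in simp)
  ultimately have lim: "(\<lambda>n. prob (?R n) + prob (?I n)) \<longlonglongrightarrow> 0"
    using tendsto_add[of "\<lambda>n. prob (?R n)" 0 sequentially "\<lambda>n. prob (?I n)" 0] by simp
  have le: "prob {\<omega> \<in> space M. \<delta> \<le> cmod (empirical_coeff n (\<lambda>k. X k \<omega>) l - \<mu>)} \<le> prob (?R n) + prob (?I n)" for n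
  proof -
    have "{\<omega> \<in> space M. \<delta> \<le> cmod (empirical_coeff n (\<lambda>k. X k \<omega>) l - \<mu>)} \<subseteq> ?R n \<union> ?I n"
    proof safe
      fix \<omega>
      assume "\<delta> \<le> cmod (empirical_coeff n (\<lambda>k. X k \<omega>) l - \<mu>)"
        and *: "\<not> \<delta> / 2 \<le> \<bar>(\<Sum>k=1..n. Im (circ_exp l (X k \<omega>))) / real n - Im \<mu>\<bar>"
      then have "\<delta> \<le> \<bar>Re (empirical_coeff n (\<lambda>k. X k \<omega>) l - \<mu>)\<bar> + \<bar>Im (empirical_coeff n (\<lambda>k. X k \<omega>) l - \<mu>)\<bar>"
        by (intro order.trans[OF _ cmod_le])
      with * show "\<delta> / 2 \<le> \<bar>(\<Sum>k=1..n. Re (circ_exp l (X k \<omega>))) / real n - Re \<mu>\<bar>"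
        by (simp add: empirical_coeff_def)
    qed
    then have "prob {\<omega> \<in> space M. \<delta> \<le> cmod (empirical_coeff n (\<lambda>k. X k \<omega>) l - \<mu>)} \<le> prob (?R n \<union> ?I n)"
      by (intro finite_measure_mono) measurable
    also have "\<dots> \<le> prob (?R n) + prob (?I n)"
      by (intro measure_Un_le) measurable
    finally show ?thesis .
  qed
  show ?thesis
    by (rule tendsto_sandwich[OF _ _ tendsto_const lim]) (use le in auto)
qed

text \<open>A union bound: a sum reaching \<delta> has a summand reaching the average share \<delta>
  / \<open>card L\<close>.\<close>

lemma (in prob_space) prob_sum_deviation:
  fixes D :: "'i \<Rightarrow> nat \<Rightarrow> 'a \<Rightarrow> real"
  assumes "finite L" "L \<noteq> {}"
    and meas: "\<And>i n. i \<in> L \<Longrightarrow> D i n \<in> borel_measurable M"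
    and lim: "\<And>i \<delta>. i \<in> L \<Longrightarrow> \<delta> > 0 \<Longrightarrow> (\<lambda>n. prob {\<omega> \<in> space M. \<delta> \<le> D i n \<omega>}) \<longlonglongrightarrow> 0"
    and "\<delta> > 0"
  shows "(\<lambda>n. prob {\<omega> \<in> space M. \<delta> \<le> (\<Sum>i\<in>L. D i n \<omega>)}) \<longlonglongrightarrow> 0"
proof -
  define c where "c = \<delta> / card L"
  have c: "c > 0" "(\<Sum>i\<in>L. c) = \<delta>"
    using assms(1,2) \<open>\<delta> > 0\<close> by (auto simp: c_def card_gt_0_iff)
  have le: "prob {\<omega> \<in> space M. \<delta> \<le> (\<Sum>i\<in>L. D i n \<omega>)} \<le> (\<Sum>i\<in>L. prob {\<omega> \<in> space M. c \<le> D i n \<omega>})" for n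
  proof -
    have sets: "{\<omega> \<in> space M. c \<le> D i n \<omega>} \<in> events" if "i \<in> L" for i
      using meas[OF that] by measurable
    have "{\<omega> \<in> space M. \<delta> \<le> (\<Sum>i\<in>L. D i n \<omega>)} \<subseteq> (\<Union>i\<in>L. {\<omega> \<in> space M. c \<le> D i n \<omega>})"
    proof (rule ccontr)
      assume "\<not> ?thesis"
      then obtain \<omega> where "\<delta> \<le> (\<Sum>i\<in>L. D i n \<omega>)" "\<And>i. i \<in> L \<Longrightarrow> D i n \<omega> < c"
        by (force simp: not_le)
      then show False
        using sum_strict_mono[OF assms(1,2), of "\<lambda>i. D i n \<omega>" "\<lambda>_. c"] c(2) by auto
    qed
    then have "prob {\<omega> \<in> space M. \<delta> \<le> (\<Sum>i\<in>L. D i n \<omega>)} \<le> prob (\<Union>i\<in>L. {\<omega> \<in> space M. c \<le> D i n \<omega>})"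
      by (intro finite_measure_mono sets.finite_UN assms(1) sets)
    also have "\<dots> \<le> (\<Sum>i\<in>L. prob {\<omega> \<in> space M. c \<le> D i n \<omega>})"
      using sets by (intro finite_measure_subadditive_finite assms(1)) auto
    finally show ?thesis .
  qed
  have "(\<lambda>n. \<Sum>i\<in>L. prob {\<omega> \<in> space M. c \<le> D i n \<omega>}) \<longlonglongrightarrow> (\<Sum>i\<in>L. 0)"
    by (intro tendsto_sum lim c(1))
  then have lim_sum: "(\<lambda>n. \<Sum>i\<in>L. prob {\<omega> \<in> space M. c \<le> D i n \<omega>}) \<longlonglongrightarrow> 0"
    by simp
  show ?thesis
    by (rule tendsto_sandwich[OF _ _ tendsto_const lim_sum]) (use le in auto)
qed

section \<open>Zeros of the limit contrast\<close>

lemma circ_exp_moment_real: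
  assumes "fourier_coeff (\<lambda>x. complex_of_real (f x)) l \<in> \<real> - {0}"
  shows "(LINT x|circle_lebesgue. f x *\<^sub>R circ_exp l x) \<in> \<real> - {0}"
    and "(LINT x|circle_lebesgue. f x *\<^sub>R circ_exp (- l) x) \<in> \<real> - {0}"
proof -
  have "(LINT x|circle_lebesgue. f x *\<^sub>R circ_exp (- l) x) =
      of_real (2 * pi) * fourier_coeff (\<lambda>x. complex_of_real (f x)) l"
    by (simp add: fourier_coeff_def scaleR_conv_of_real)
  then show neg: "(LINT x|circle_lebesgue. f x *\<^sub>R circ_exp (- l) x) \<in> \<real> - {0}"
    using assms by (auto intro!: Reals_mult)
  \<comment> \<open>Since \<open>f\<close> is real-valued, opposite frequencies have conjugate
    moments; this carries the hypothesis over to the other sign of \<open>l\<close>.\<close>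
  have "(LINT x|circle_lebesgue. f x *\<^sub>R circ_exp l x) =
      (LINT x|circle_lebesgue. cnj (f x *\<^sub>R circ_exp (- l) x))"
    by (simp add: circ_exp_minus_index)
  also have "\<dots> = cnj (LINT x|circle_lebesgue. f x *\<^sub>R circ_exp (- l) x)"
    by (rule Bochner_Integration.integral_cnj)
  also have "\<dots> \<in> \<real> - {0}"
    using neg by (auto simp: complex_is_Real_iff)
  finally show "(LINT x|circle_lebesgue. f x *\<^sub>R circ_exp l x) \<in> \<real> - {0}" .
qed

text \<open>Each product is the real number \<open>F l\<close> times a squared modulus, so its
  imaginary part vanishes.\<close>

lemma limit_contrast_self:
  assumes "\<And>l. l \<in> {-4..4} \<Longrightarrow> F l \<in> \<real>"
  shows "limit_contrast (\<lambda>l. F l * cnj (mix_fourier l \<theta>)) \<theta> = 0"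
  unfolding limit_contrast_def
proof (intro sum.neutral ballI)
  fix l :: int assume "l \<in> {-4..4}"
  then obtain r where r: "F l = of_real r"
    using assms by (auto elim: Reals_cases)
  have "F l * cnj (mix_fourier l \<theta>) * mix_fourier l \<theta> = of_real (r * (cmod (mix_fourier l \<theta>))\<^sup>2)"
    unfolding r of_real_mult complex_norm_square by (simp add: mult_ac)
  then show "(Im (F l * cnj (mix_fourier l \<theta>) * mix_fourier l \<theta>))\<^sup>2 = 0"
    by (simp only: Im_complex_of_real) simp
qed

text \<open>A vanishing sum of squares vanishes termwise, and for l = 1, ..., 4 the nonzero real
  factor \<open>F l\<close> can be cancelled, which leaves the hypothesis of
  identifiability.\<close>

lemma limit_contrast_eq_0D:
  assumes "\<theta> \<in> admissible" "\<theta>' \<in> admissible"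
    and F: "\<And>l. l \<in> {1, 2, 3, 4} \<Longrightarrow> F l \<in> \<real> - {0}"
    and zero: "limit_contrast (\<lambda>l. F l * cnj (mix_fourier l \<theta>')) \<theta> = 0"
  shows "\<theta> = \<theta>' \<or> \<theta> = shift_pi \<theta>'"
proof (rule mix_fourier_identifiable[OF assms(1,2)])
  fix l :: int assume l: "l \<in> {1, 2, 3, 4}"
  have "\<forall>l\<in>{-4..4}. (Im (F l * cnj (mix_fourier l \<theta>') * mix_fourier l \<theta>))\<^sup>2 = 0"
    using zero unfolding limit_contrast_def by (subst (asm) sum_nonneg_eq_0_iff) auto
  moreover have "l \<in> {-4..4}"
    using l by auto
  ultimately have "(Im (F l * cnj (mix_fourier l \<theta>') * mix_fourier l \<theta>))\<^sup>2 = 0"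
    by blast
  moreover obtain r where r: "F l = of_real r" "r \<noteq> 0"
    using F[OF l] by (auto elim: Reals_cases)
  have "F l * cnj (mix_fourier l \<theta>') * mix_fourier l \<theta> =
      r *\<^sub>R (mix_fourier l \<theta> * cnj (mix_fourier l \<theta>'))"
    by (simp add: r(1) scaleR_conv_of_real)
  ultimately have "(r * Im (mix_fourier l \<theta> * cnj (mix_fourier l \<theta>')))\<^sup>2 = 0"
    by (simp only: scaleR_complex.sel)
  then show "Im (mix_fourier l \<theta> * cnj (mix_fourier l \<theta>')) = 0"
    using r(2) by (simp only: zero_eq_power2 mult_eq_0_iff) simp
qed

lemma param_diff_self: "param_diff \<theta> \<theta> = 0"
proof -
  have "circ_rep 0 = 0"
    using abs_circ_rep[of 0] circ_exp_circ[of 1 0] by (simp add: circ_zero)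
  then show ?thesis
    by (cases \<theta>) (simp add: zero_prod_def)
qed

theorem theorem4:
  fixes \<Theta> :: "param set"
    and \<theta>\<^sub>0 :: param
    and f :: "circle \<Rightarrow> real"
    and M :: "'w measure"
    and X :: "nat \<Rightarrow> 'w \<Rightarrow> circle"
    and \<theta>hat :: "nat \<Rightarrow> 'w \<Rightarrow> param"
  assumes "compact \<Theta>"
    and "\<Theta> \<subseteq> admissible"
    and "\<theta>\<^sub>0 \<in> \<Theta>"
    and "circle_density f"
    and "\<forall>l\<in>{1, 2, 3, 4}. fourier_coeff (\<lambda>x. complex_of_real (f x)) l \<in> \<real> - {0}"
    and "prob_space M"
    and "prob_space.indep_vars M (\<lambda>_. borel) X {1..}"
    and "\<forall>k\<ge>1. distributed M circle_lebesgue (X k) (\<lambda>x. ennreal (mixture f \<theta>\<^sub>0 x))"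
    and "\<forall>n\<ge>2. \<theta>hat n \<in> borel_measurable M"
    and "\<forall>n\<ge>2. \<forall>\<omega>\<in>space M.
           is_arg_min (contrast n (\<lambda>k. X k \<omega>)) (\<lambda>\<theta>. \<theta> \<in> \<Theta>) (\<theta>hat n \<omega>)"
  shows "\<forall>\<epsilon>>0. (\<lambda>n. measure M {\<omega> \<in> space M.
             norm (param_diff (\<theta>hat n \<omega>) \<theta>\<^sub>0) \<le> \<epsilon> \<or>
             norm (param_diff (\<theta>hat n \<omega>) (shift_pi \<theta>\<^sub>0)) \<le> \<epsilon>}) \<longlonglongrightarrow> 1"
proof (intro allI impI)
  fix \<epsilon> :: real assume "\<epsilon> > 0"
  interpret prob_space M by fact
  have \<theta>\<^sub>0: "\<theta>\<^sub>0 \<in> admissible"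
    using assms(2,3) by auto
  have X [measurable]: "X k \<in> borel_measurable M" if "k \<ge> 1" for k
    using assms(7) that by (auto simp: indep_vars_def)
  have f [measurable]: "f \<in> borel_measurable borel" and f_nonneg: "\<And>x. 0 \<le> f x"
    and f_int: "(LINT x|circle_lebesgue. f x) = 1"
    using assms(4) by (auto simp: circle_density_def)
  have mix: "0 \<le> mixture f \<theta>\<^sub>0 x" for x
    using \<theta>\<^sub>0 f_nonneg by (cases \<theta>\<^sub>0) (auto simp: admissible_def)
  have mix_meas: "mixture f \<theta>\<^sub>0 \<in> borel_measurable borel"
  proof -
    obtain p \<alpha> \<beta> where \<theta>: "\<theta>\<^sub>0 = (p, \<alpha>, \<beta>)" by (cases \<theta>\<^sub>0)
    have "mixture f \<theta>\<^sub>0 = (\<lambda>x. p * f (x - \<alpha>) + (1 - p) * f (x - \<beta>))"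
      by (auto simp: \<theta>)
    then show ?thesis
      by simp
  qed
  define F where "F l = (LINT x|circle_lebesgue. f x *\<^sub>R circ_exp l x)" for l
  define m where "m l = F l * cnj (mix_fourier l \<theta>\<^sub>0)" for l
  have F: "F l \<in> \<real> - {0}" "F (- l) \<in> \<real> - {0}" if "l \<in> {1, 2, 3, 4}" for l
    using circ_exp_moment_real assms(5) that by (auto simp: F_def)
  have F_real: "F l \<in> \<real>" if "l \<in> {-4..4}" for l
  proof -
    have "l = 0 \<or> l \<in> {1, 2, 3, 4} \<or> - l \<in> {1, 2, 3, 4}"
      using that by auto
    moreover have "F 0 = 1"
      using f_int by (simp add: F_def scaleR_conv_of_real)
    ultimately show ?thesis
      using F(1)[of l] F(2)[of "- l"] by auto
  qed
  have mean: "expectation (\<lambda>\<omega>. circ_exp l (X k \<omega>)) = m l" if "k \<ge> 1" for k l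
  proof -
    have d: "distr M circle_lebesgue (X k) = density circle_lebesgue (\<lambda>x. ennreal (mixture f \<theta>\<^sub>0 x))"
      "X k \<in> measurable M circle_lebesgue"
      using assms(8) that by (auto simp: distributed_def)
    have "expectation (\<lambda>\<omega>. circ_exp l (X k \<omega>)) = (LINT x|distr M circle_lebesgue (X k). circ_exp l x)"
      using d(2) by (intro integral_distr[symmetric]) auto
    also have "\<dots> = (LINT x|circle_lebesgue. mixture f \<theta>\<^sub>0 x *\<^sub>R circ_exp l x)"
      unfolding d(1) using mix mix_meas by (intro integral_density) auto
    also have "\<dots> = m l"
      unfolding m_def F_def by (rule integral_mixture_circ_exp[OF assms(4)])
    finally show ?thesis .
  qed
  \<comment> \<open>The number \<open>m l\<close> is the mean of a variable of modulus one.\<close>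
  have m_le: "cmod (m l) \<le> 1" for l
  proof -
    have "cmod (expectation (\<lambda>\<omega>. circ_exp l (X 1 \<omega>))) \<le> expectation (\<lambda>\<omega>. cmod (circ_exp l (X 1 \<omega>)))"
      by (rule integral_norm_bound)
    then show ?thesis
      by (simp add: mean prob_space)
  qed
  have self: "limit_contrast m \<theta>\<^sub>0 = 0"
    unfolding m_def[abs_def] using F_real by (rule limit_contrast_self)
  define near where "near \<theta> \<longleftrightarrow> norm (param_diff \<theta> \<theta>\<^sub>0) \<le> \<epsilon> \<or> norm (param_diff \<theta> (shift_pi \<theta>\<^sub>0)) \<le> \<epsilon>" for \<theta>
  \<comment> \<open>The weak inequality keeps \<open>K\<close> closed. It meets \<open>near\<close>
    only at distance exactly \<epsilon>, and every point outside \<open>K\<close> is near.\<close>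
  define K where "K = {\<theta>. \<epsilon> \<le> norm (param_diff \<theta> \<theta>\<^sub>0)} \<inter> {\<theta>. \<epsilon> \<le> norm (param_diff \<theta> (shift_pi \<theta>\<^sub>0))}"
  have "compact (\<Theta> \<inter> K)"
    unfolding K_def
    by (intro compact_Int_closed assms(1) closed_Int closed_Collect_le continuous_on_norm_param_diff continuous_on_const)
  have pos: "limit_contrast m \<theta> > 0" if "\<theta> \<in> \<Theta> \<inter> K" for \<theta>
  proof (rule ccontr)
    assume "\<not> ?thesis"
    moreover have "limit_contrast m \<theta> \<ge> 0"
      by (auto simp: limit_contrast_def intro!: sum_nonneg)
    ultimately have "limit_contrast m \<theta> = 0"
      by simp
    then have "limit_contrast (\<lambda>l. F l * cnj (mix_fourier l \<theta>\<^sub>0)) \<theta> = 0"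
      unfolding m_def[abs_def] .
    moreover have "\<theta> \<in> admissible"
      using that assms(2) by blast
    ultimately have "\<theta> = \<theta>\<^sub>0 \<or> \<theta> = shift_pi \<theta>\<^sub>0"
      using \<theta>\<^sub>0 F(1) by (intro limit_contrast_eq_0D)
    then show False
      using that \<open>\<epsilon> > 0\<close> by (auto simp: K_def param_diff_self)
  qed
  \<comment> \<open>The minimum over the compact set \<open>\<Theta> \<inter> K\<close> separates
    the limit contrast from zero there; if that set is empty, any positive number will do.\<close>
  obtain \<eta> where \<eta>: "\<eta> > 0" "\<And>\<theta>. \<theta> \<in> \<Theta> \<inter> K \<Longrightarrow> \<eta> \<le> limit_contrast m \<theta>"
  proof (cases "\<Theta> \<inter> K = {}")
    case True
    then show ?thesis
      using that[of 1] by auto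
  next
    case False
    then obtain \<theta>\<^sub>1 where "\<theta>\<^sub>1 \<in> \<Theta> \<inter> K" "\<forall>\<theta>\<in>\<Theta> \<inter> K. limit_contrast m \<theta>\<^sub>1 \<le> limit_contrast m \<theta>"
      using continuous_attains_inf[OF \<open>compact (\<Theta> \<inter> K)\<close> False
          continuous_on_subset[OF continuous_on_limit_contrast subset_UNIV]] by blast
    then show ?thesis
      using that[of "limit_contrast m \<theta>\<^sub>1"] pos by auto
  qed
  define dev where "dev n \<omega> = (\<Sum>l=-4..4. cmod (empirical_coeff n (\<lambda>k. X k \<omega>) l - m l))" for n \<omega>
  have emp_meas [measurable]: "(\<lambda>\<omega>. cmod (empirical_coeff n (\<lambda>k. X k \<omega>) l - m l)) \<in> borel_measurable M" for n l
  proof -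
    have "(\<lambda>\<omega>. circ_exp l (X k \<omega>)) \<in> borel_measurable M" if "k \<in> {1..n}" for k
      using X[of k] that by simp
    then show ?thesis
      unfolding empirical_coeff_def by measurable
  qed
  have dev_meas [measurable]: "dev n \<in> borel_measurable M" for n
    unfolding dev_def by measurable
  \<comment> \<open>The threshold is chosen so that \<open>4 * dev n \<omega>\<close> stays below
    \<eta>/2; the other half of \<eta> absorbs \<open>18 / real n\<close> for large
    \<open>n\<close>.\<close>
  have dev_lim: "(\<lambda>n. prob {\<omega> \<in> space M. \<eta> / 8 \<le> dev n \<omega>}) \<longlonglongrightarrow> 0"
    unfolding dev_def
  proof (rule prob_sum_deviation)
    show "(\<lambda>n. prob {\<omega> \<in> space M. \<delta> \<le> cmod (empirical_coeff n (\<lambda>k. X k \<omega>) l - m l)}) \<longlonglongrightarrow> 0"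
      if "\<delta> > 0" for l \<delta>
      using that by (intro prob_empirical_coeff_deviation assms(7) mean)
  qed (use \<eta>(1) emp_meas in auto)
  have ev: "\<forall>\<^sub>F n in sequentially. 1 - prob {\<omega> \<in> space M. \<eta> / 8 \<le> dev n \<omega>} \<le>
      prob {\<omega> \<in> space M. near (\<theta>hat n \<omega>)}"
  proof -
    have "\<forall>\<^sub>F n in sequentially. 18 / real n < \<eta> / 2"
      using \<eta>(1) by real_asymp
    then show ?thesis
      using eventually_ge_at_top[of 2]
    proof eventually_elim
      case (elim n)
      have [measurable]: "\<theta>hat n \<in> borel_measurable M"
        using assms(9) elim by auto
      \<comment> \<open>A closed set is Borel, so the event in question is measurable and
        monotonicity of the probability can be applied to it.\<close>
      have "closed {\<theta>. near \<theta>}"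
        unfolding near_def
        by (intro closed_Collect_disj closed_Collect_le continuous_on_norm_param_diff continuous_on_const)
      then have near_meas: "{\<omega> \<in> space M. near (\<theta>hat n \<omega>)} \<in> events"
        using measurable_sets[of "\<theta>hat n" M borel "{\<theta>. near \<theta>}"] by (simp add: vimage_def Int_def conj_commute)
      have "{\<omega> \<in> space M. \<not> \<eta> / 8 \<le> dev n \<omega>} \<subseteq> {\<omega> \<in> space M. near (\<theta>hat n \<omega>)}"
      proof safe
        fix \<omega> assume \<omega>: "\<omega> \<in> space M" "\<not> \<eta> / 8 \<le> dev n \<omega>"
        have min: "is_arg_min (contrast n (\<lambda>k. X k \<omega>)) (\<lambda>\<theta>. \<theta> \<in> \<Theta>) (\<theta>hat n \<omega>)"
          using assms(10) \<omega>(1) elim by auto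
        have "limit_contrast m (\<theta>hat n \<omega>) \<le> limit_contrast m \<theta>\<^sub>0 + 4 * dev n \<omega> + 18 / real n"
          unfolding dev_def by (rule limit_contrast_arg_min_le[OF elim(2) assms(2,3) m_le min])
        also have "\<dots> < \<eta>"
          using elim(1) \<omega>(2) self by simp
        finally have "\<theta>hat n \<omega> \<notin> \<Theta> \<inter> K"
          using \<eta>(2)[of "\<theta>hat n \<omega>"] by linarith
        moreover have "\<theta>hat n \<omega> \<in> \<Theta>"
          using min by (simp add: is_arg_min_def)
        ultimately show "near (\<theta>hat n \<omega>)"
          by (auto simp: K_def near_def)
      qed
      then have "prob {\<omega> \<in> space M. \<not> \<eta> / 8 \<le> dev n \<omega>} \<le> prob {\<omega> \<in> space M. near (\<theta>hat n \<omega>)}"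
        using near_meas by (rule finite_measure_mono)
      moreover have "{\<omega> \<in> space M. \<eta> / 8 \<le> dev n \<omega>} \<in> events"
        by measurable
      ultimately show ?case
        using prob_neg[of "\<lambda>\<omega>. \<eta> / 8 \<le> dev n \<omega>"] by simp
    qed
  qed
  have "(\<lambda>n. prob {\<omega> \<in> space M. near (\<theta>hat n \<omega>)}) \<longlonglongrightarrow> 1"
  proof (rule tendsto_sandwich[OF ev])
    show "(\<lambda>n. 1 - prob {\<omega> \<in> space M. \<eta> / 8 \<le> dev n \<omega>}) \<longlonglongrightarrow> 1"
      using tendsto_diff[OF tendsto_const[of 1] dev_lim] by simp
  qed (auto intro: tendsto_const)
  then show "(\<lambda>n. measure M {\<omega> \<in> space M.
             norm (param_diff (\<theta>hat n \<omega>) \<theta>\<^sub>0) \<le> \<epsilon> \<or>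
             norm (param_diff (\<theta>hat n \<omega>) (shift_pi \<theta>\<^sub>0)) \<le> \<epsilon>}) \<longlonglongrightarrow> 1"
    by (simp only: near_def)
qed

end
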